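(* There is an algorithm that, given an $n$-vertex graph $G$, a positive integer $\rho$, and a distance-$\rho$ tree-partition-decomposition of $G$ of width at most $k$ and degree at most $\Delta$, computes $\alpha_{2\rho}(G)$ in time $n^{\mathcal{O}(\Delta k)}$.
   Context: Graphs are finite, undirected and unweighted, with shortest-path distance $\mathrm{dist}$. A distance-$r$ independent set is a set $I\subseteq V(G)$ with $\mathrm{dist}(u,v)>r$ for all distinct $u,v\in I$; $\alpha_r(G)$ is the maximum size of a distance-$r$ independent set in $G$. For $A\subseteq V(G)$, $\gamma_\rho(A,G)$ is the minimum size of a set $D\subseteq V(G)$ such that every $u\in A$ has some $d\in D$ with $\mathrm{dist}(u,d)\le\rho$. A distance-$\rho$ tree-partition-decomposition of $G$ consists of a tree $T$ and sets $C_x\subseteq V(G)$ for $x\in V(T)$ such that $\{C_x\}$ is a partition of $V(G)$ and whenever $\mathrm{dist}(u,v)\le\rho$ with $u\in C_x$, $v\in C_y$, the nodes $x,y$ are equal or adjacent in $T$. Its width is $\max_x \gamma_\rho(C_x,G)$ and its degree is the maximum degree of $T$. *)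

theory Defs
  imports Main "HOL-Library.Extended_Nat" "HOL-Library.Disjoint_Sets"
begin

section \<open>Graphs\<close>

text \<open>Each undirected edge \<open>uv\<close> is represented by the two pairs \<open>(u, v)\<close> and \<open>(v, u)\<close>.\<close>

record 'a graph =
  verts :: "'a set"
  edges :: "('a \<times> 'a) set"

definition simple_graph :: "'a graph \<Rightarrow> bool" where
  "simple_graph G \<longleftrightarrow>
     finite (verts G) \<and> edges G \<subseteq> verts G \<times> verts G \<and> sym (edges G) \<and> irrefl (edges G)"

text \<open>The distance is the length of a shortest walk; it is \<open>\<infinity>\<close> (the infimum of the empty set)
  between different components.\<close>

definition gdist :: "'a graph \<Rightarrow> 'a \<Rightarrow> 'a \<Rightarrow> enat" where
  "gdist G u v = (INF l \<in> {l. (u, v) \<in> edges G ^^ l}. enat l)"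

definition connected_graph :: "'a graph \<Rightarrow> bool" where
  "connected_graph G \<longleftrightarrow> (\<forall>u\<in>verts G. \<forall>v\<in>verts G. (u, v) \<in> (edges G)\<^sup>*)"

definition is_cycle :: "'a graph \<Rightarrow> 'a list \<Rightarrow> bool" where
  "is_cycle G p \<longleftrightarrow> length p \<ge> 3 \<and> distinct p \<and> set p \<subseteq> verts G \<and>
     (\<forall>i<length p. (p ! i, p ! (Suc i mod length p)) \<in> edges G)"

definition is_tree :: "'a graph \<Rightarrow> bool" where
  "is_tree T \<longleftrightarrow>
     simple_graph T \<and> verts T \<noteq> {} \<and> connected_graph T \<and> (\<nexists>p. is_cycle T p)"

definition degree :: "'a graph \<Rightarrow> 'a \<Rightarrow> nat" where
  "degree G x = card {y. (x, y) \<in> edges G}"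

definition max_degree :: "'a graph \<Rightarrow> nat" where
  "max_degree G = Max (degree G ` verts G)"


section \<open>Distance independence, distance domination, tree-partition-decompositions\<close>

definition dist_indep :: "nat \<Rightarrow> 'a graph \<Rightarrow> 'a set \<Rightarrow> bool" where
  "dist_indep r G I \<longleftrightarrow>
     I \<subseteq> verts G \<and> (\<forall>u\<in>I. \<forall>v\<in>I. u \<noteq> v \<longrightarrow> gdist G u v > enat r)"

definition alpha :: "nat \<Rightarrow> 'a graph \<Rightarrow> nat" where
  "alpha r G = Max {card I | I. dist_indep r G I}"

definition dist_dominates :: "nat \<Rightarrow> 'a graph \<Rightarrow> 'a set \<Rightarrow> 'a set \<Rightarrow> bool" where
  "dist_dominates \<rho> G D A \<longleftrightarrow>
     D \<subseteq> verts G \<and> (\<forall>u\<in>A. \<exists>d\<in>D. gdist G u d \<le> enat \<rho>)"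

definition gamma :: "nat \<Rightarrow> 'a set \<Rightarrow> 'a graph \<Rightarrow> nat" where
  "gamma \<rho> A G = Min {card D | D. dist_dominates \<rho> G D A}"

text \<open>\<^const>\<open>partition_on\<close> makes all parts nonempty, so \<open>T\<close> has at most as many nodes as \<open>G\<close> has
  vertices; \<^const>\<open>inj_on\<close> says that different nodes carry different parts.\<close>

definition tree_partition_decomp ::
    "nat \<Rightarrow> 'a graph \<Rightarrow> 'b graph \<Rightarrow> ('b \<Rightarrow> 'a set) \<Rightarrow> bool" where
  "tree_partition_decomp \<rho> G T C \<longleftrightarrow>
     is_tree T \<and>
     partition_on (verts G) (C ` verts T) \<and> inj_on C (verts T) \<and>
     (\<forall>x\<in>verts T. \<forall>y\<in>verts T. \<forall>u\<in>C x. \<forall>v\<in>C y.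
        gdist G u v \<le> enat \<rho> \<longrightarrow> x = y \<or> (x, y) \<in> edges T)"

definition decomp_width :: "nat \<Rightarrow> 'a graph \<Rightarrow> 'b graph \<Rightarrow> ('b \<Rightarrow> 'a set) \<Rightarrow> nat" where
  "decomp_width \<rho> G T C = Max ((\<lambda>x. gamma \<rho> (C x) G) ` verts T)"


section \<open>Machine model\<close>

text \<open>
  Algorithms are programs of a random access machine, written as structured while programs.
  The memory consists of registers and arrays of natural numbers; register and array names are
  fixed in the program (so a program uses finitely many of them), array indices are computed.
  Every evaluated operator, every memory access and every executed command costs one unit.
  The only arithmetic operations are addition and truncated subtraction, so that a number grows
  by at most one bit per unit of time and running times agree with those of Turing machines up
  to a polynomial; with multiplication at unit cost this would fail.
\<close>

datatype aexp =
    Const nat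
  | Var nat
  | Elem nat aexp
  | Plus aexp aexp
  | Minus aexp aexp

datatype bexp =
    Less aexp aexp
  | Equal aexp aexp
  | Neg bexp
  | Conj bexp bexp

datatype com =
    Skip
  | Assign nat aexp
  | Store nat aexp aexp
  | Seq com com
  | Cond bexp com com
  | While bexp com

record state =
  regs :: "nat \<Rightarrow> nat"
  arrs :: "nat \<Rightarrow> nat \<Rightarrow> nat"

fun aval :: "aexp \<Rightarrow> state \<Rightarrow> nat" where
  "aval (Const k) s = k"
| "aval (Var x) s = regs s x"
| "aval (Elem a e) s = arrs s a (aval e s)"
| "aval (Plus e f) s = aval e s + aval f s"
| "aval (Minus e f) s = aval e s - aval f s"

fun acost :: "aexp \<Rightarrow> nat" where
  "acost (Const k) = 1"
| "acost (Var x) = 1"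
| "acost (Elem a e) = 1 + acost e"
| "acost (Plus e f) = 1 + acost e + acost f"
| "acost (Minus e f) = 1 + acost e + acost f"

fun bval :: "bexp \<Rightarrow> state \<Rightarrow> bool" where
  "bval (Less e f) s \<longleftrightarrow> aval e s < aval f s"
| "bval (Equal e f) s \<longleftrightarrow> aval e s = aval f s"
| "bval (Neg b) s \<longleftrightarrow> \<not> bval b s"
| "bval (Conj b d) s \<longleftrightarrow> bval b s \<and> bval d s"

fun bcost :: "bexp \<Rightarrow> nat" where
  "bcost (Less e f) = 1 + acost e + acost f"
| "bcost (Equal e f) = 1 + acost e + acost f"
| "bcost (Neg b) = 1 + bcost b"
| "bcost (Conj b d) = 1 + bcost b + bcost d"

text \<open>\<open>exec p s t s'\<close>: started in \<open>s\<close>, program \<open>p\<close> halts in \<open>s'\<close> after time \<open>t\<close>.\<close>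

inductive exec :: "com \<Rightarrow> state \<Rightarrow> nat \<Rightarrow> state \<Rightarrow> bool" where
  Skip: "exec Skip s 1 s"
| Assign: "exec (Assign x e) s (1 + acost e) (s\<lparr>regs := (regs s)(x := aval e s)\<rparr>)"
| Store: "exec (Store a e f) s (1 + acost e + acost f)
    (s\<lparr>arrs := (arrs s)(a := (arrs s a)(aval e s := aval f s))\<rparr>)"
| Seq: "exec p s t s' \<Longrightarrow> exec q s' t' s'' \<Longrightarrow> exec (Seq p q) s (t + t') s''"
| CondTrue: "bval b s \<Longrightarrow> exec p s t s' \<Longrightarrow> exec (Cond b p q) s (1 + bcost b + t) s'"
| CondFalse: "\<not> bval b s \<Longrightarrow> exec q s t s' \<Longrightarrow> exec (Cond b p q) s (1 + bcost b + t) s'"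
| WhileFalse: "\<not> bval b s \<Longrightarrow> exec (While b p) s (1 + bcost b) s"
| WhileTrue: "bval b s \<Longrightarrow> exec p s t s' \<Longrightarrow> exec (While b p) s' t' s'' \<Longrightarrow>
    exec (While b p) s (1 + bcost b + t + t') s''"

inductive_cases SkipE: "exec Skip s t s'"
  and AssignE: "exec (Assign x e) s t s'"
  and StoreE: "exec (Store a e f) s t s'"
  and SeqE: "exec (Seq p q) s t s'"
  and CondE: "exec (Cond b p q) s t s'"
  and WhileE: "exec (While b p) s t s'"

lemma exec_deterministic:
  "exec p s t s' \<Longrightarrow> exec p s u s'' \<Longrightarrow> u = t \<and> s'' = s'"
proof (induction arbitrary: u s'' rule: exec.induct)
  case Skip then show ?case by (auto elim: SkipE)
next
  case Assign then show ?case by (auto elim: AssignE)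
next
  case Store then show ?case by (auto elim: StoreE)
next
  case Seq from Seq.prems show ?case by (rule SeqE) (use Seq.IH in fastforce)
next
  case CondTrue from CondTrue.prems show ?case by (rule CondE) (use CondTrue in fastforce)+
next
  case CondFalse from CondFalse.prems show ?case by (rule CondE) (use CondFalse in fastforce)+
next
  case WhileFalse from WhileFalse.prems show ?case by (rule WhileE) (use WhileFalse in fastforce)+
next
  case WhileTrue from WhileTrue.prems show ?case by (rule WhileE) (use WhileTrue in fastforce)+
qed

text \<open>The input is stored in array 0, everything else is 0; the result is read off register 0.\<close>

definition init_state :: "nat list \<Rightarrow> state" where
  "init_state xs =
     \<lparr>regs = (\<lambda>_. 0), arrs = (\<lambda>a i. if a = 0 \<and> i < length xs then xs ! i else 0)\<rparr>"

definition result :: "state \<Rightarrow> nat" where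
  "result s = regs s 0"


section \<open>Encoding of instances\<close>

text \<open>
  For a graph with vertex set \<open>{..<n}\<close> and a tree with node set \<open>{..<m}\<close> the input consists of
  \<open>n\<close>, \<open>m\<close>, \<open>\<rho>\<close>, the two adjacency matrices and the incidence matrix of the parts, row by row.
\<close>

definition matrix_list :: "nat \<Rightarrow> nat \<Rightarrow> (nat \<Rightarrow> nat \<Rightarrow> bool) \<Rightarrow> nat list" where
  "matrix_list a b R = concat (map (\<lambda>i. map (\<lambda>j. of_bool (R i j)) [0..<b]) [0..<a])"

definition encode_instance ::
    "nat \<Rightarrow> nat \<Rightarrow> nat \<Rightarrow> nat graph \<Rightarrow> nat graph \<Rightarrow> (nat \<Rightarrow> nat set) \<Rightarrow> nat list" where
  "encode_instance n m \<rho> G T C =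
     [n, m, \<rho>]
     @ matrix_list n n (\<lambda>u v. (u, v) \<in> edges G)
     @ matrix_list m m (\<lambda>x y. (x, y) \<in> edges T)
     @ matrix_list m n (\<lambda>x v. v \<in> C x)"

end

theory Submission
  imports Defs "HOL-Library.Nat_Bijection"
begin

text \<open>
  A ball of radius \<open>\<rho>\<close> contains at most one vertex of a distance-\<open>2\<rho>\<close> independent set \<open>I\<close>, so \<open>I\<close> has
  at most \<open>k\<close> vertices in each bag and at most \<open>(\<Delta> + 1)k\<close> in the bags of a closed neighbourhood of \<open>T\<close>.
  Two vertices at distance at most \<open>2\<rho>\<close> lie in bags with a common closed neighbour, by taking the
  midpoint of a shortest path. Hence dynamic programming along \<open>T\<close> works: peel leaves \<open>x\<close> one by one,
  list the \<open>n\<^bsup>O(\<Delta>k)\<^esup>\<close> independent subsets \<open>A\<close> of the bags around \<open>x\<close>, and store for each trace of \<open>A\<close> on the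
  bags of \<open>x\<close> and of its remaining neighbour the best number of vertices that can be gained in the
  peeled bags. The program does not need to know \<open>k\<close> or \<open>\<Delta>\<close>, as these only bound the length of the list.
\<close>

section \<open>Running time of programs\<close>

text \<open>A fixed program has a constant loop nesting \<open>cdepth\<close>. If no loop makes more
  than \<open>B\<close> iterations, its time is at most \<open>csize\<close> times
  \<open>Suc B ^ cdepth\<close>, so with \<open>B = 2 * n ^ (4 * d * k)\<close> the nesting merely
  multiplies the exponent. One crude bound for all loops is therefore enough, provided that even the
  search for vertices within distance \<open>2 * \<rho>\<close> obeys it. As \<rho> is an input
  number unrelated to \<open>n\<close>, the radius is first cut to \<open>n * n\<close>, beyond
  which nothing new is reachable. The machine only adds and subtracts. A listed set is thus stored
  as a pointer to an earlier set plus one new vertex: compatibility with a further vertex, sums over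
  the set and its table address each follow from the value at the pointer by one update. Array
  indices are unbounded, so the trace itself, written in binary, is the address of its entry and no
  search takes place. Correctness rests on gluing: a set on the bags that stay live and a set on the
  bags around \<open>x\<close> may be combined as soon as they agree on the bags common to both
  families.\<close>

fun csize :: "com \<Rightarrow> nat" where
  "csize Skip = 1"
| "csize (Assign x e) = 1 + acost e"
| "csize (Store a e f) = 1 + acost e + acost f"
| "csize (Seq p q) = csize p + csize q"
| "csize (Cond b p q) = 1 + bcost b + csize p + csize q"
| "csize (While b p) = 1 + bcost b + csize p"

fun cdepth :: "com \<Rightarrow> nat" where
  "cdepth (Seq p q) = max (cdepth p) (cdepth q)"
| "cdepth (Cond b p q) = max (cdepth p) (cdepth q)"
| "cdepth (While b p) = Suc (cdepth p)"
| "cdepth _ = 0"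

fun wregs :: "com \<Rightarrow> nat set" where
  "wregs (Assign x e) = {x}"
| "wregs (Seq p q) = wregs p \<union> wregs q"
| "wregs (Cond b p q) = wregs p \<union> wregs q"
| "wregs (While b p) = wregs p"
| "wregs _ = {}"

fun warrs :: "com \<Rightarrow> nat set" where
  "warrs (Store a e f) = {a}"
| "warrs (Seq p q) = warrs p \<union> warrs q"
| "warrs (Cond b p q) = warrs p \<union> warrs q"
| "warrs (While b p) = warrs p"
| "warrs _ = {}"

definition frame :: "nat set \<Rightarrow> nat set \<Rightarrow> state \<Rightarrow> state \<Rightarrow> bool" where
  "frame X Y s s' \<longleftrightarrow> (\<forall>x. x \<notin> X \<longrightarrow> regs s' x = regs s x) \<and> (\<forall>a. a \<notin> Y \<longrightarrow> arrs s' a = arrs s a)"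

text \<open>What a program leaves untouched is read off its text. The rules
  \<open>runs_mono\<close>, \<open>runs_For\<close> and \<open>runs_Seq'\<close> hand this frame to
  their users, so that invariants only have to mention what changes.\<close>

lemma exec_frame: "exec p s t s' \<Longrightarrow> frame (wregs p) (warrs p) s s'"
  by (induction rule: exec.induct) (auto simp: frame_def)

text \<open>The time bound in \<open>runs\<close> is preserved by all program constructs as soon as every loop makes at
  most \<open>B\<close> iterations, so time never has to be tracked in the correctness proofs.\<close>

definition runs :: "nat \<Rightarrow> com \<Rightarrow> state \<Rightarrow> (state \<Rightarrow> bool) \<Rightarrow> bool" where
  "runs B p s Q \<longleftrightarrow> (\<exists>t s'. exec p s t s' \<and> t \<le> csize p * Suc B ^ cdepth p \<and> Q s')"

lemma runs_mono:
  assumes "runs B p s Q" "\<And>s'. Q s' \<Longrightarrow> frame (wregs p) (warrs p) s s' \<Longrightarrow> Q' s'"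
  shows "runs B p s Q'"
  using assms exec_frame unfolding runs_def by blast

lemma runs_Skip: "Q s \<Longrightarrow> runs B Skip s Q"
  unfolding runs_def by (intro exI conjI, rule exec.Skip) auto

lemma runs_Assign:
  "Q (s\<lparr>regs := (regs s)(x := aval e s)\<rparr>) \<Longrightarrow> runs B (Assign x e) s Q"
  unfolding runs_def by (intro exI conjI, rule exec.Assign) auto

lemma runs_Store:
  "Q (s\<lparr>arrs := (arrs s)(a := (arrs s a)(aval e s := aval f s))\<rparr>) \<Longrightarrow> runs B (Store a e f) s Q"
  unfolding runs_def by (intro exI conjI, rule exec.Store) auto

lemma runs_Seq:
  assumes "runs B p s (\<lambda>s'. runs B q s' Q)"
  shows "runs B (Seq p q) s Q"
proof -
  obtain t s' u s'' where *: "exec p s t s'" "t \<le> csize p * Suc B ^ cdepth p"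
    "exec q s' u s''" "u \<le> csize q * Suc B ^ cdepth q" "Q s''"
    using assms unfolding runs_def by blast
  have "csize p * Suc B ^ cdepth p \<le> csize p * Suc B ^ cdepth (Seq p q)"
    by (intro mult_left_mono power_increasing) auto
  moreover have "csize q * Suc B ^ cdepth q \<le> csize q * Suc B ^ cdepth (Seq p q)"
    by (intro mult_left_mono power_increasing) auto
  ultimately have "t + u \<le> csize (Seq p q) * Suc B ^ cdepth (Seq p q)"
    using *(2,4) unfolding csize.simps add_mult_distrib by linarith
  then show ?thesis
    unfolding runs_def using * exec.Seq by blast
qed

lemma runs_Cond:
  assumes "bval b s \<Longrightarrow> runs B p s Q" and "\<not> bval b s \<Longrightarrow> runs B q s Q"
  shows "runs B (Cond b p q) s Q"
proof -
  define r where "r = (if bval b s then p else q)"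
  have "runs B r s Q" using assms by (simp add: r_def)
  then obtain t s' where *: "exec r s t s'" "t \<le> csize r * Suc B ^ cdepth r" "Q s'"
    unfolding runs_def by blast
  have "exec (Cond b p q) s (1 + bcost b + t) s'"
    using *(1) exec.CondTrue exec.CondFalse by (auto simp: r_def split: if_splits)
  moreover have "1 + bcost b + t \<le> csize (Cond b p q) * Suc B ^ cdepth (Cond b p q)"
  proof -
    have "csize r * Suc B ^ cdepth r \<le> csize r * Suc B ^ cdepth (Cond b p q)"
      by (intro mult_left_mono power_increasing) (auto simp: r_def)
    also have "\<dots> \<le> (csize p + csize q) * Suc B ^ cdepth (Cond b p q)"
      by (intro mult_right_mono) (auto simp: r_def)
    moreover have "(1 + bcost b) * 1 \<le> (1 + bcost b) * Suc B ^ cdepth (Cond b p q)"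
      by (intro mult_left_mono) auto
    ultimately show ?thesis
      using *(2) unfolding csize.simps add_mult_distrib mult_1_right by linarith
  qed
  ultimately show ?thesis unfolding runs_def using *(3) by blast
qed

section \<open>Counting loops\<close>

definition For :: "nat \<Rightarrow> nat \<Rightarrow> com \<Rightarrow> com" where
  "For i k p = Seq (Assign i (Const 0))
     (While (Less (Var i) (Var k)) (Seq p (Assign i (Plus (Var i) (Const 1)))))"

lemma wregs_For [simp]: "wregs (For i k p) = insert i (wregs p)"
  and warrs_For [simp]: "warrs (For i k p) = warrs p"
  by (auto simp: For_def)

lemma exec_While_iterate:
  assumes "\<And>j s. j < N \<Longrightarrow> P j s \<Longrightarrow> bval b s \<and> (\<exists>t s'. exec p s t s' \<and> t \<le> K \<and> P (Suc j) s')"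
    and "\<And>s. P N s \<Longrightarrow> \<not> bval b s"
    and "j \<le> N" "P j s"
  shows "\<exists>t s'. exec (While b p) s t s' \<and> t \<le> (N - j) * (1 + bcost b + K) + (1 + bcost b) \<and> P N s'"
  using assms(3,4)
proof (induction "N - j" arbitrary: j s)
  case 0
  then have "j = N" by simp
  then show ?case using exec.WhileFalse assms(2) 0 by force
next
  case (Suc d)
  then have "j < N" by simp
  then obtain t s' where 1: "bval b s" "exec p s t s'" "t \<le> K" "P (Suc j) s'"
    using assms(1) Suc by blast
  obtain u s'' where 2: "exec (While b p) s' u s''"
    "u \<le> (N - Suc j) * (1 + bcost b + K) + (1 + bcost b)" "P N s''"
    using Suc(1)[OF _ _ 1(4)] Suc(2) \<open>j < N\<close> by (metis Suc_leI diff_Suc_Suc diff_Suc_1 Suc_diff_Suc)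
  have eq: "N - j = Suc (N - Suc j)" using \<open>j < N\<close> by simp
  have "1 + bcost b + t + u \<le> (N - j) * (1 + bcost b + K) + (1 + bcost b)"
    unfolding eq using 1(3) 2(2) by simp
  then show ?case using exec.WhileTrue[OF 1(1,2) 2(1)] 2(3) by blast
qed

text \<open>The body writes neither the counter nor the bound, hence it runs exactly
  \<open>regs s k\<close> times. The invariant at \<open>Suc j\<close> is demanded for the state
  after the increment that the loop itself appends to the body.\<close>

lemma runs_For:
  assumes "i \<noteq> k" "k \<notin> wregs p" "i \<notin> wregs p" and N: "regs s k \<le> B"
    and "I 0 (s\<lparr>regs := (regs s)(i := 0)\<rparr>)"
    and body: "\<And>j s'. \<lbrakk>j < regs s k; regs s' i = j; I j s'; frame (insert i (wregs p)) (warrs p) s s'\<rbrakk>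
        \<Longrightarrow> runs B p s' (\<lambda>s''. I (Suc j) (s''\<lparr>regs := (regs s'')(i := Suc j)\<rparr>))"
    and fin: "\<And>s'. \<lbrakk>I (regs s k) s'; regs s' i = regs s k; frame (insert i (wregs p)) (warrs p) s s'\<rbrakk> \<Longrightarrow> Q s'"
  shows "runs B (For i k p) s Q"
proof -
  let ?N = "regs s k" and ?b = "Less (Var i) (Var k)"
  let ?p = "Seq p (Assign i (Plus (Var i) (Const 1)))"
  let ?s = "s\<lparr>regs := (regs s)(i := 0)\<rparr>"
  let ?K = "csize ?p * Suc B ^ cdepth p"
  define P where "P j s' \<longleftrightarrow> regs s' i = j \<and> I j s' \<and> frame (insert i (wregs p)) (warrs p) s s'" for j s'
  have "bval ?b s' \<and> (\<exists>t s''. exec ?p s' t s'' \<and> t \<le> ?K \<and> P (Suc j) s'')" if "j < ?N" "P j s'" for j s'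
  proof
    show "bval ?b s'" using that assms(1,2) by (auto simp: P_def frame_def)
    have "runs B p s' (\<lambda>s''. I (Suc j) (s''\<lparr>regs := (regs s'')(i := Suc j)\<rparr>))"
      using that body by (auto simp: P_def)
    then have "runs B ?p s' (P (Suc j))"
      apply (intro runs_Seq)
      apply (erule runs_mono)
      apply (rule runs_Assign)
      using that assms(3) by (auto simp: P_def frame_def)
    then show "\<exists>t s''. exec ?p s' t s'' \<and> t \<le> ?K \<and> P (Suc j) s''"
      by (auto simp: runs_def)
  qed
  moreover have "\<not> bval ?b s'" if "P ?N s'" for s'
    using that assms(1,2) by (auto simp: P_def frame_def)
  moreover have "P 0 ?s" using assms(5) by (auto simp: P_def frame_def)
  ultimately obtain t s' where *: "exec (While ?b ?p) ?s t s'"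
    "t \<le> (?N - 0) * (1 + bcost ?b + ?K) + (1 + bcost ?b)" "P ?N s'"
    using exec_While_iterate[of ?N P ?b ?p ?K 0 ?s] by blast
  have "t \<le> csize (While ?b ?p) * Suc B ^ cdepth (While ?b ?p)"
  proof -
    \<comment> \<open>The test is evaluated once more than the body; this is why the base of the
      power is \<open>Suc B\<close> and not \<open>B\<close>.\<close>
    have "t \<le> Suc ?N * (1 + bcost ?b + ?K)" using *(2) by simp
    also have "\<dots> \<le> Suc B * (1 + bcost ?b + ?K)" using N by (intro mult_right_mono) auto
    also have "\<dots> \<le> Suc B * ((1 + bcost ?b + csize ?p) * Suc B ^ cdepth p)"
    proof (intro mult_left_mono)
      have "(1 + bcost ?b) * 1 \<le> (1 + bcost ?b) * Suc B ^ cdepth p"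
        by (intro mult_left_mono) auto
      then show "1 + bcost ?b + ?K \<le> (1 + bcost ?b + csize ?p) * Suc B ^ cdepth p"
        unfolding add_mult_distrib by linarith
    qed simp
    also have "\<dots> = csize (While ?b ?p) * Suc B ^ cdepth (While ?b ?p)"
      unfolding csize.simps(6) cdepth.simps max_0R power_Suc by (rule mult.left_commute)
    finally show ?thesis .
  qed
  with *(1,3) have "runs B (While ?b ?p) ?s Q"
    unfolding runs_def using fin by (auto simp: P_def)
  then show ?thesis
    unfolding For_def by (intro runs_Seq runs_Assign) simp
qed

section \<open>Conflicts and leaf peeling\<close>

text \<open>Extremal argument: otherwise the first vertex of a longest path inside \<open>S\<close>
  has a neighbour in \<open>S\<close> besides its successor, and this neighbour either prolongs the
  path or closes a cycle.\<close>

lemma forest_leaf: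
  assumes T: "simple_graph T" "\<nexists>p. is_cycle T p" and S: "S \<subseteq> verts T" "S \<noteq> {}"
  shows "\<exists>x\<in>S. \<exists>p. {y\<in>S. (x, y) \<in> edges T} \<subseteq> {p}"
proof (rule ccontr)
  assume "\<not> ?thesis"
  then have two: "\<exists>y\<in>S. (x, y) \<in> edges T \<and> y \<noteq> p" if "x \<in> S" for x p
    using that by blast
  have fin: "finite S" using T S by (meson finite_subset simple_graph_def)
  define P where "P p \<longleftrightarrow> p \<noteq> [] \<and> distinct p \<and> set p \<subseteq> S \<and>
    (\<forall>i. Suc i < length p \<longrightarrow> (p ! i, p ! Suc i) \<in> edges T)" for p
  obtain x0 where "x0 \<in> S" using S by blast
  then have "P [x0]" by (simp add: P_def)
  moreover have "length p \<le> card S" if "P p" for p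
    using that fin by (metis P_def card_mono distinct_card)
  ultimately obtain p where p: "P p" "\<And>q. P q \<Longrightarrow> length q \<le> length p"
    using ex_has_greatest_nat[of P "[x0]" length "Suc (card S)"] by (auto simp: less_Suc_eq_le)
  have p0: "p ! 0 \<in> S" using p(1) by (auto simp: P_def)
  \<comment> \<open>On a path with one vertex \<open>p ! 1\<close> is an unspecified value. This is
    harmless: \<open>w\<close> in \<open>set p\<close> then means \<open>w = p ! 0\<close>, which
    irreflexivity excludes below.\<close>
  then obtain w where w: "w \<in> S" "(p ! 0, w) \<in> edges T" "w \<noteq> p ! 1"
    using two by blast
  have "w \<in> set p"
  proof (rule ccontr)
    assume "w \<notin> set p"
    moreover have "(w, p ! 0) \<in> edges T" using w T by (auto simp: simple_graph_def dest: symD)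
    ultimately have "P (w # p)"
      using p(1) w by (auto simp: P_def nth_Cons split: nat.splits)
    then show False using p(2) by fastforce
  qed
  then obtain j where j: "j < length p" "w = p ! j" by (auto simp: in_set_conv_nth)
  have "j \<noteq> 0"
  proof
    assume "j = 0"
    then show False using w j T(1) by (simp add: simple_graph_def irrefl_def)
  qed
  moreover have "j \<noteq> 1" using w j by auto
  ultimately have "j \<ge> 2" by simp
  have "is_cycle T (take (Suc j) p)"
  proof -
    have "(take (Suc j) p ! i, take (Suc j) p ! (Suc i mod Suc j)) \<in> edges T" if "i < Suc j" for i
    proof (cases "i = j")
      case True
      then show ?thesis using w j T by (auto simp: simple_graph_def dest: symD)
    next
      case False
      then show ?thesis using that j p(1) by (auto simp: P_def)
    qed
    then show ?thesis
      using j \<open>j \<ge> 2\<close> p(1) S(1) set_take_subset[of "Suc j" p] by (auto simp: is_cycle_def P_def)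
  qed
  then show False using T by blast
qed

text \<open>An infimum in \<open>enat\<close> is attained unless the set is empty, and then it is
  infinite. From here on distances are handled as lengths of walks.\<close>

lemma gdist_le_iff: "gdist G u v \<le> enat r \<longleftrightarrow> (\<exists>l\<le>r. (u, v) \<in> edges G ^^ l)"
proof
  assume le: "gdist G u v \<le> enat r"
  let ?L = "{l. (u, v) \<in> edges G ^^ l}"
  have ne: "enat ` ?L \<noteq> {}"
  proof
    assume "enat ` ?L = {}"
    then have "gdist G u v = \<infinity>" by (simp add: gdist_def top_enat_def)
    then show False using le by simp
  qed
  have "Inf (enat ` ?L) \<in> enat ` ?L"
    using ne by (meson wellorder_InfI ex_in_conv)
  then show "\<exists>l\<le>r. (u, v) \<in> edges G ^^ l" using le by (auto simp: gdist_def)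
next
  assume "\<exists>l\<le>r. (u, v) \<in> edges G ^^ l"
  then obtain l where "l \<le> r" "(u, v) \<in> edges G ^^ l" by blast
  then have "gdist G u v \<le> enat l" unfolding gdist_def by (intro INF_lower) simp
  then show "gdist G u v \<le> enat r" using \<open>l \<le> r\<close> by (meson enat_ord_simps(1) order_trans)
qed

lemma gdist_refl: "gdist G u u \<le> enat r"
  unfolding gdist_le_iff by (intro exI[of _ 0]) simp

lemma relpow_sym: "sym R \<Longrightarrow> (x, y) \<in> R ^^ l \<Longrightarrow> (y, x) \<in> R ^^ l"
proof (induction l arbitrary: y)
  case (Suc l)
  then obtain z where "(x, z) \<in> R ^^ l" "(z, y) \<in> R" by auto
  then have "(z, x) \<in> R ^^ l" "(y, z) \<in> R" using Suc by (auto dest: symD)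
  then show ?case by (rule relpow_Suc_I2[rotated])
qed simp

lemma gdist_sym:
  assumes "simple_graph G" shows "gdist G u v = gdist G v u"
proof -
  have "(u, v) \<in> edges G ^^ l \<longleftrightarrow> (v, u) \<in> edges G ^^ l" for l
    using assms relpow_sym[of "edges G"] by (auto simp: simple_graph_def)
  then show ?thesis by (simp add: gdist_def)
qed

lemma gdist_triangle:
  assumes "gdist G u w \<le> enat a" "gdist G w v \<le> enat b"
  shows "gdist G u v \<le> enat (a + b)"
  using assms unfolding gdist_le_iff by (metis add_mono relcomp.relcompI relpow_add)

text \<open>Cut a walk of length \<open>l\<close> after \<open>min l a\<close> steps. The last
  alternative makes \<open>w\<close> a vertex whenever \<open>u\<close> is one; this does not come
  for free, as walks of length 0 exist at arbitrary elements.\<close>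

lemma gdist_midpoint:
  assumes "gdist G u v \<le> enat (a + b)"
  obtains w where "gdist G u w \<le> enat a" "gdist G w v \<le> enat b" "w = u \<or> w \<in> snd ` edges G"
proof -
  obtain l where l: "l \<le> a + b" "(u, v) \<in> edges G ^^ l" using assms by (auto simp: gdist_le_iff)
  define i where "i = min l a"
  have "(u, v) \<in> edges G ^^ (i + (l - i))" using l(2) by (simp add: i_def)
  then obtain w where w: "(u, w) \<in> edges G ^^ i" "(w, v) \<in> edges G ^^ (l - i)"
    unfolding relpow_add by blast
  have "w = u \<or> w \<in> snd ` edges G"
  proof (cases i)
    case 0 then show ?thesis using w(1) by simp
  next
    case (Suc i')
    then obtain z where "(z, w) \<in> edges G" using w(1) by auto
    then show ?thesis by force
  qed
  moreover have "i \<le> a" "l - i \<le> b" using l(1) by (auto simp: i_def)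
  moreover have "gdist G u w \<le> enat a" "gdist G w v \<le> enat b"
    using w calculation unfolding gdist_le_iff by blast+
  ultimately show ?thesis using that by blast
qed

section \<open>Bags and conflicts in a fixed decomposition\<close>

locale decomposition =
  fixes n m \<rho> :: nat and G T :: "nat graph" and C :: "nat \<Rightarrow> nat set"
  assumes G: "simple_graph G" and vG: "verts G = {..<n}" and vT: "verts T = {..<m}"
    and tpd: "tree_partition_decomp \<rho> G T C"
begin

definition adj where "adj x y \<longleftrightarrow> (x, y) \<in> edges T"

definition nbh where "nbh x = insert x {y. adj x y}"

text \<open>The guard makes \<open>bag m\<close> empty although \<open>C m\<close> is unconstrained,
  so that the number \<open>m\<close> can play the role of a missing parent.\<close>

definition bag where "bag x = {v. x < m \<and> v \<in> C x}"

abbreviation bags where "bags X \<equiv> \<Union> (bag ` X)"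

abbreviation indep where "indep \<equiv> dist_indep (2 * \<rho>) G"

lemma T: "simple_graph T" "\<nexists>p. is_cycle T p"
  using tpd by (auto simp: tree_partition_decomp_def is_tree_def)

lemma adj_sym: "adj x y \<Longrightarrow> adj y x"
  using T(1) by (auto simp: adj_def simple_graph_def dest: symD)

lemma adj_irrefl: "\<not> adj x x"
  using T(1) by (auto simp: adj_def simple_graph_def irrefl_def)

lemma adj_less: "adj x y \<Longrightarrow> x < m \<and> y < m"
  using T(1) vT by (auto simp: adj_def simple_graph_def)

lemma bag_less: "v \<in> bag x \<Longrightarrow> v < n"
  using tpd vG vT by (auto simp: bag_def tree_partition_decomp_def partition_on_def)

lemma bag_disjoint: "v \<in> bag x \<Longrightarrow> v \<in> bag y \<Longrightarrow> x = y"
  using tpd vT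
  by (auto simp: bag_def tree_partition_decomp_def partition_on_def disjoint_def inj_on_def)
    (metis IntI empty_iff imageI lessThan_iff)

lemma bag_cover: "v < n \<Longrightarrow> \<exists>x<m. v \<in> bag x"
  using tpd vG vT by (auto simp: bag_def tree_partition_decomp_def partition_on_def)

lemma bags_all: "bags {..<m} = {..<n}"
  using bag_cover bag_less by (auto simp: Bex_def)

lemma bags_Int: "bags X \<inter> bags Y = bags (X \<inter> Y)"
  using bag_disjoint by blast

lemma indep_subset: "indep I \<Longrightarrow> J \<subseteq> I \<Longrightarrow> indep J"
  by (auto simp: dist_indep_def)

lemma indepD: "indep I \<Longrightarrow> u \<in> I \<Longrightarrow> v \<in> I \<Longrightarrow> u \<noteq> v \<Longrightarrow> \<not> gdist G u v \<le> enat (2 * \<rho>)"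
  by (auto simp: dist_indep_def not_le)

lemma indep_less: "indep I \<Longrightarrow> I \<subseteq> {..<n}"
  by (auto simp: dist_indep_def vG)

lemma indep_finite: "indep I \<Longrightarrow> finite I"
  using indep_less finite_subset by blast

text \<open>The midpoint of a short path lies in a bag close to the bags of both endpoints.\<close>

lemma conflict_common_nbh:
  assumes "u \<in> bag a" "v \<in> bag b" "gdist G u v \<le> enat (2 * \<rho>)"
  obtains z where "z \<in> nbh a" "z \<in> nbh b"
proof -
  have "gdist G u v \<le> enat (\<rho> + \<rho>)" using assms by (simp add: mult_2)
  then obtain w where w: "gdist G u w \<le> enat \<rho>" "gdist G w v \<le> enat \<rho>"
    "w = u \<or> w \<in> snd ` edges G"
    by (rule gdist_midpoint)
  have "w < n" using w(3) bag_less[OF assms(1)] G vG by (auto simp: simple_graph_def)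
  then obtain z where z: "z < m" "w \<in> bag z" using bag_cover by blast
  have near: "y \<in> nbh x" if "u \<in> bag x" "v \<in> bag y" "gdist G u v \<le> enat \<rho>" for u v x y
  proof -
    have "x = y \<or> (x, y) \<in> edges T"
      using tpd that vT unfolding tree_partition_decomp_def bag_def by blast
    then show ?thesis by (auto simp: nbh_def adj_def)
  qed
  show ?thesis
    using near[OF assms(1) z(2) w(1)] near[OF assms(2) z(2)] w(2) gdist_sym[OF G] that by metis
qed

text \<open>The state of the leaf peeling: \<open>R\<close> is the set of peeled nodes, \<open>par x\<close> the unpeeled neighbour of
  \<open>x\<close> when \<open>x\<close> was peeled, or \<open>m\<close> if there was none. A peeled node stays live until its parent is
  peeled, because its vertices can still conflict with the bags next to the parent.\<close>

definition tops where "tops R par = {x \<in> R. par x \<notin> R \<and> par x < m}"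

definition live where "live R par = ({..<m} - R) \<union> tops R par"

definition best :: "nat set \<Rightarrow> nat set \<Rightarrow> nat \<Rightarrow> bool" where
  "best U J v \<longleftrightarrow> (\<exists>I. indep I \<and> I \<inter> U = J \<and> card I = v) \<and>
     (\<forall>I. indep I \<longrightarrow> I \<inter> U = J \<longrightarrow> card I \<le> v)"

text \<open>The bag of a node in \<open>tops R par\<close> is live, yet its vertices are counted
  inside \<open>f x\<close> together with those of the bags below \<open>x\<close>; the cardinality
  therefore ranges over unpeeled bags only. \<open>base\<close> collects what was gained when a node
  without a parent was peeled.\<close>

definition estimate where
  "estimate R par f base J = base + card (J \<inter> bags ({..<m} - R)) +
     (\<Sum>x\<in>tops R par. f x (J \<inter> (bag x \<union> bag (par x))))"

text \<open>The clauses on \<open>adj\<close> say that every tree edge touching \<open>R\<close>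
  joins a node to its \<open>par\<close>, so \<open>R\<close> is a forest hanging from unpeeled
  nodes. The last clause is the claim of the dynamic program: the estimate is the optimum over all
  extensions of a given trace on the live bags.\<close>

definition peeled where
  "peeled R par f base \<longleftrightarrow> R \<subseteq> {..<m} \<and>
     (\<forall>x\<in>R. par x < m \<longrightarrow> adj x (par x)) \<and>
     (\<forall>x\<in>R. \<forall>y. adj x y \<longrightarrow> y \<in> R \<or> y = par x) \<and>
     (\<forall>x\<in>R. \<forall>y\<in>R. adj x y \<longrightarrow> par x = y \<or> par y = x) \<and>
     (\<forall>J. indep J \<longrightarrow> J \<subseteq> bags (live R par) \<longrightarrow> best (bags (live R par)) J (estimate R par f base J))"

lemma peeled_init: "peeled {} par f 0"
proof -
  have "best {..<n} J (card (J \<inter> {..<n}))" if "indep J" for J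
    using that indep_less[OF that] indep_less unfolding best_def
    by (metis Int_absorb2 order_refl)
  then show ?thesis
    by (auto simp: peeled_def live_def tops_def estimate_def bags_all)
qed

lemma peeled_final:
  assumes "peeled {..<m} par f base"
  shows "alpha (2 * \<rho>) G = base"
proof -
  have tops: "tops {..<m} par = {}" by (auto simp: tops_def)
  then have live: "live {..<m} par = {}" by (auto simp: live_def)
  have "indep {}" by (simp add: dist_indep_def)
  then have "best {} {} base"
    using assms by (auto simp: peeled_def live estimate_def tops)
  then have *: "\<exists>I. indep I \<and> card I = base" "\<And>I. indep I \<Longrightarrow> card I \<le> base"
    by (auto simp: best_def)
  then show ?thesis unfolding alpha_def
    by (intro Max_eqI) (auto intro: finite_subset[of _ "{..base}"])
qed

text \<open>Gluing argument. \<open>K\<close> consists of the bags that are around \<open>x\<close>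
  and still live afterwards. A live bag that can conflict with a bag ceasing to be live is itself
  around \<open>x\<close> (\<open>sep\<close>), so independent sets on the two families that agree
  on \<open>K\<close> have an independent union. The optimum for \<open>J\<close> thus splits into a
  part depending on \<open>J\<close> alone and the best \<open>val A\<close> with
  \<open>A \<inter> K = J \<inter> K\<close>, which is what \<open>g\<close> tabulates.\<close>

lemma peeled_step:
  assumes peeled: "peeled R par f base" and x: "x < m" "x \<notin> R"
    and p: "p \<le> m" "{y. adj x y \<and> y \<notin> R} = {p} \<inter> {..<m}"
    and K: "K = (if p < m then bag x \<union> bag p else {})"
    and g: "\<And>S. S \<subseteq> K \<Longrightarrow> indep S \<Longrightarrow>
        (\<exists>A. A \<subseteq> bags (nbh x) \<and> indep A \<and> A \<inter> K = S \<and> val A = g S) \<and>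
        (\<forall>A. A \<subseteq> bags (nbh x) \<longrightarrow> indep A \<longrightarrow> A \<inter> K = S \<longrightarrow> val A \<le> g S)"
    and val: "\<And>A. val A = card (A \<inter> bag x) + (\<Sum>y | adj x y \<and> y \<noteq> p. f y (A \<inter> (bag x \<union> bag y)))"
  shows "peeled (insert x R) (par(x := p)) (f(x := g)) (base + (if p < m then 0 else g {}))"
proof -
  define ch where "ch = {y. adj x y \<and> y \<noteq> p}"
  let ?R = "insert x R" and ?par = "par(x := p)" and ?f = "f(x := g)"
  let ?base = "base + (if p < m then 0 else g {})"
  have Rm: "R \<subseteq> {..<m}"
    and par_adj: "\<And>y. y \<in> R \<Longrightarrow> par y < m \<Longrightarrow> adj y (par y)"
    and closed: "\<And>y z. y \<in> R \<Longrightarrow> adj y z \<Longrightarrow> z \<in> R \<or> z = par y"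
    and edge: "\<And>y z. y \<in> R \<Longrightarrow> z \<in> R \<Longrightarrow> adj y z \<Longrightarrow> par y = z \<or> par z = y"
    and best: "\<And>J. indep J \<Longrightarrow> J \<subseteq> bags (live R par) \<Longrightarrow>
      best (bags (live R par)) J (estimate R par f base J)"
    using peeled unfolding peeled_def by blast+
  have pR: "p \<notin> R" "p \<noteq> x" "p < m \<Longrightarrow> adj x p"
    using p Rm x adj_irrefl by (auto simp: set_eq_iff)
  have adj_p: "y = p" if "adj x y" "y \<notin> R" for y using p that by (auto simp: set_eq_iff)
  \<comment> \<open>Every neighbour of \<open>x\<close> except \<open>p\<close> is peeled, and a
    peeled node has no unpeeled neighbour besides its parent; as \<open>x\<close> is unpeeled, it is
    that parent.\<close>
  have ch: "ch = {y \<in> R. par y = x}"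
  proof (intro set_eqI iffI)
    fix y assume "y \<in> ch"
    then have "adj y x" "y \<in> R" using adj_p adj_sym by (auto simp: ch_def)
    then show "y \<in> {y \<in> R. par y = x}" using closed[of y x] x by auto
  next
    fix y assume "y \<in> {y \<in> R. par y = x}"
    then show "y \<in> ch" using par_adj[of y] adj_sym[of y x] pR x by (auto simp: ch_def)
  qed
  have ch_tops: "ch \<subseteq> tops R par" using ch x by (auto simp: tops_def)
  have tops': "tops ?R ?par = (tops R par - ch) \<union> (if p < m then {x} else {})"
    using x pR unfolding ch by (auto simp: tops_def)
  have live': "live ?R ?par = live R par - (ch \<union> (if p < m then {} else {x}))"
    unfolding live_def tops' using x ch by (auto simp: tops_def)
  let ?U = "live R par" and ?U' = "live ?R ?par"
  have nbh_x: "nbh x = insert x ch \<union> ({p} \<inter> {..<m})"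
    unfolding nbh_def ch_def using pR by (auto dest: adj_less)
  have nbh_U: "nbh x \<subseteq> ?U"
    unfolding nbh_x live_def using ch_tops x pR by auto
  \<comment> \<open>Without a parent \<open>x\<close> itself ceases to be live and nothing is
    shared; this is the empty branch in the definition of \<open>K\<close>.\<close>
  have kept: "nbh x \<inter> ?U' = (if p < m then {x, p} else {})"
    unfolding nbh_x live' using ch_tops x pR p(1) ch by (auto simp: live_def tops_def)
  then have K': "K = bags (nbh x) \<inter> bags ?U'"
    unfolding bags_Int K by auto
  have not_live: "y \<notin> ?U'" if "y \<in> R" "par y \<in> R \<or> par y = x" for y
    using that x ch unfolding live' live_def tops_def by auto
  \<comment> \<open>The bags that cease to be live conflict with a live bag only inside the neighbourhood of \<open>x\<close>.\<close>
  have sep1: "w = x" if c: "c \<in> ch" and w: "w \<in> nbh c" "w \<in> ?U'" for c w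
    using c w closed[of c w] edge[of c w] not_live[of w] not_live[of c] unfolding ch nbh_def by auto
  have sep2: "w \<in> nbh x" if "c \<in> ch" and z: "z \<in> nbh c" and w: "w \<in> nbh z" "w \<in> ?U'" for c z w
  proof -
    have c: "c \<in> R" "par c = x" using that(1) ch by auto
    consider "z = c" | "z = x" | "z \<in> R" "par z = c" "z \<noteq> c"
      using z c closed[of c z] edge[of c z] x(2) unfolding nbh_def by auto
    then show ?thesis
    proof cases
      case 1 then show ?thesis using sep1 that by (auto simp: nbh_def)
    next
      case 2 then show ?thesis using w by simp
    next
      case 3
      then show ?thesis
        using w c closed[of z w] edge[of z w] not_live[of w] not_live[of z] not_live[of c]
        unfolding nbh_def by auto
    qed
  qed
  have nbh_sym: "a \<in> nbh b \<Longrightarrow> b \<in> nbh a" for a b by (auto simp: nbh_def adj_sym)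
  have sep: "w \<in> nbh x" if a: "a \<in> nbh x" "a \<notin> ?U'" and w: "w \<in> ?U'" and z: "z \<in> nbh a" "z \<in> nbh w" for a w z
  proof -
    consider "a \<in> ch" | "a = x" "\<not> p < m"
    proof (cases "p < m")
      case True
      then have "a \<notin> {x, p}" using kept a by auto
      then show ?thesis using a(1) by (auto simp: nbh_x intro: that(1))
    next
      case False
      then show ?thesis using a(1) by (auto simp: nbh_x intro: that)
    qed
    then show ?thesis
    proof cases
      case 1
      then show ?thesis using sep2[of a z w] z w nbh_sym[of z w] by blast
    next
      case 2
      then have "z = x \<or> z \<in> ch" using z(1) by (auto simp: nbh_x)
      then show ?thesis using sep1[of z w] w z nbh_sym[of z w] nbh_sym[of x w] by (auto simp: nbh_def)
    qed
  qed
  have fin: "finite (tops R par)" using Rm by (auto simp: tops_def intro: finite_subset)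
  \<comment> \<open>The part of the estimate on which the old and the new state agree.\<close>
  define rest where "rest J = base + card (J \<inter> bags ({..<m} - ?R)) +
     (\<Sum>z\<in>tops R par - ch. f z (J \<inter> (bag z \<union> bag (par z))))" for J
  have est': "estimate ?R ?par ?f ?base J = rest J + g (J \<inter> K)" for J
  proof -
    have "x \<notin> tops R par - ch" using x by (auto simp: tops_def)
    moreover have "(\<Sum>z\<in>tops R par - ch. ?f z (J \<inter> (bag z \<union> bag (?par z)))) =
        (\<Sum>z\<in>tops R par - ch. f z (J \<inter> (bag z \<union> bag (par z))))"
      using x by (intro sum.cong) (auto simp: tops_def)
    ultimately show ?thesis
      using fin by (simp add: estimate_def rest_def tops' K)
  qed
  \<comment> \<open>In the old estimate the bag of \<open>x\<close> and the tables of its children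
    depend only on the trace around \<open>x\<close> and make up \<open>val\<close>; all other terms
    see only bags that remain live.\<close>
  have est: "estimate R par f base I = rest (I \<inter> bags ?U') + val (I \<inter> bags (nbh x))"
    if "finite I" for I
  proof -
    let ?J = "I \<inter> bags ?U'" and ?A = "I \<inter> bags (nbh x)"
    have 1: "card (I \<inter> bags ({..<m} - R)) = card (?J \<inter> bags ({..<m} - ?R)) + card (?A \<inter> bag x)"
    proof -
      have "{..<m} - ?R \<subseteq> ?U'" using x ch unfolding live' live_def by auto
      then have *: "?J \<inter> bags ({..<m} - ?R) = I \<inter> bags ({..<m} - ?R)" by blast
      have **: "?A \<inter> bag x = I \<inter> bag x" by (auto simp: nbh_def)
      have "{..<m} - R = insert x ({..<m} - ?R)" using x by auto
      then have "I \<inter> bags ({..<m} - R) = (I \<inter> bags ({..<m} - ?R)) \<union> (I \<inter> bag x)" by auto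
      moreover have "(I \<inter> bags ({..<m} - ?R)) \<inter> (I \<inter> bag x) = {}" using bag_disjoint by blast
      ultimately show ?thesis using that unfolding * ** by (simp add: card_Un_disjoint)
    qed
    have "(\<Sum>z\<in>tops R par. f z (I \<inter> (bag z \<union> bag (par z)))) =
        (\<Sum>z\<in>tops R par - ch. f z (I \<inter> (bag z \<union> bag (par z)))) +
        (\<Sum>z\<in>ch. f z (I \<inter> (bag z \<union> bag (par z))))"
      using sum.subset_diff[OF ch_tops fin] .
    also have "(\<Sum>z\<in>tops R par - ch. f z (I \<inter> (bag z \<union> bag (par z)))) =
        (\<Sum>z\<in>tops R par - ch. f z (?J \<inter> (bag z \<union> bag (par z))))"
    proof (intro sum.cong refl)
      fix z assume z: "z \<in> tops R par - ch"
      then have "z \<in> ?U'" "par z \<in> ?U'"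
        using x ch unfolding live' live_def tops_def by auto
      then have "I \<inter> (bag z \<union> bag (par z)) = ?J \<inter> (bag z \<union> bag (par z))" by blast
      then show "f z (I \<inter> (bag z \<union> bag (par z))) = f z (?J \<inter> (bag z \<union> bag (par z)))" by simp
    qed
    also have "(\<Sum>z\<in>ch. f z (I \<inter> (bag z \<union> bag (par z)))) =
        (\<Sum>z\<in>ch. f z (?A \<inter> (bag x \<union> bag z)))"
    proof (intro sum.cong refl)
      fix z assume z: "z \<in> ch"
      then have "par z = x" "z \<in> nbh x" "x \<in> nbh x" using ch by (auto simp: nbh_x)
      then have "I \<inter> (bag z \<union> bag (par z)) = ?A \<inter> (bag x \<union> bag z)" by blast
      then show "f z (I \<inter> (bag z \<union> bag (par z))) = f z (?A \<inter> (bag x \<union> bag z))" by simp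
    qed
    finally have 2: "(\<Sum>z\<in>tops R par. f z (I \<inter> (bag z \<union> bag (par z)))) =
        (\<Sum>z\<in>tops R par - ch. f z (?J \<inter> (bag z \<union> bag (par z)))) +
        (\<Sum>z\<in>ch. f z (?A \<inter> (bag x \<union> bag z)))" .
    show ?thesis
      unfolding estimate_def rest_def val 1 2 ch_def[symmetric] by (simp only: ac_simps)
  qed
  have U'U: "?U' \<subseteq> ?U" unfolding live' by auto
  have "best (bags ?U') J (estimate ?R ?par ?f ?base J)" if J: "indep J" "J \<subseteq> bags ?U'" for J
  proof -
    let ?S = "J \<inter> K"
    have S: "?S \<subseteq> K" "indep ?S" using J indep_subset by auto
    then obtain A where A: "A \<subseteq> bags (nbh x)" "indep A" "A \<inter> K = ?S" "val A = g ?S"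
      using conjunct1[OF g[OF S]] by blast
    have "indep (J \<union> A)"
    proof -
      have *: "gdist G u v > enat (2 * \<rho>)" if uv: "u \<in> J" "v \<in> A" "u \<noteq> v" for u v
      proof (rule ccontr)
        assume "\<not> ?thesis"
        then have le: "gdist G u v \<le> enat (2 * \<rho>)" by simp
        obtain w where w: "w \<in> ?U'" "u \<in> bag w" using uv J by blast
        obtain a where a: "a \<in> nbh x" "v \<in> bag a" using uv A by blast
        show False
        proof (cases "a \<in> ?U'")
          case True
          then have "v \<in> J" using A(3) K' uv a by blast
          then show False using indepD[OF J(1)] uv le by blast
        next
          case False
          obtain z where "z \<in> nbh w" "z \<in> nbh a" using conflict_common_nbh[OF w(2) a(2) le] .
          then have "w \<in> nbh x" using sep a False w by blast
          then have "u \<in> A" using A(3) K' uv w by blast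
          then show False using indepD[OF A(2)] uv le by blast
        qed
      qed
      then have "gdist G v u > enat (2 * \<rho>)" if "u \<in> J" "v \<in> A" "u \<noteq> v" for u v
        using that gdist_sym[OF G] by metis
      with * show ?thesis using J(1) A(2) unfolding dist_indep_def by blast
    qed
    have glue: "(J \<union> A) \<inter> Y = J \<and> (J \<union> A) \<inter> X = A"
      if "J \<subseteq> Y" "A \<subseteq> X" "A \<inter> (X \<inter> Y) = J \<inter> (X \<inter> Y)" for X Y
      using that by blast
    note int = glue[OF J(2) A(1) A(3)[unfolded K']]
    note int1 = conjunct1[OF int] and int2 = conjunct2[OF int]
    have bags_U: "bags ?U' \<subseteq> bags ?U" "bags (nbh x) \<subseteq> bags ?U"
      using U'U nbh_U by (intro UN_mono; simp)+
    then have "J \<union> A \<subseteq> bags ?U" using J(2) A(1) by (meson Un_least order_trans)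
    then have "best (bags ?U) (J \<union> A) (estimate R par f base (J \<union> A))"
      using best \<open>indep (J \<union> A)\<close> by blast
    then obtain I where I: "indep I" "I \<inter> bags ?U = J \<union> A" "card I = estimate R par f base (J \<union> A)"
      unfolding best_def by blast
    have "I \<inter> bags ?U' = J"
      using int1 bags_U(1) unfolding I(2)[symmetric] by (simp only: Int_assoc Int_absorb1)
    moreover have "card I = estimate ?R ?par ?f ?base J"
      unfolding I(3) est' est[OF indep_finite[OF \<open>indep (J \<union> A)\<close>]] int1 int2 A(4) ..
    \<comment> \<open>Optimality: for an arbitrary competitor, its part inside
      \<open>bags (nbh x)\<close> is one of the sets over which \<open>g\<close> maximises.\<close>
    moreover have "card I \<le> estimate ?R ?par ?f ?base J" if I: "indep I" "I \<inter> bags ?U' = J" for I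
    proof -
      let ?I = "I \<inter> bags ?U"
      have i: "indep ?I" by (rule indep_subset[OF I(1) Int_lower1])
      then have "best (bags ?U) ?I (estimate R par f base ?I)" using best by blast
      then have "card I \<le> estimate R par f base ?I" using I by (auto simp: best_def)
      also have "\<dots> = rest J + val (?I \<inter> bags (nbh x))"
      proof -
        have "?I \<inter> bags ?U' = J" using I(2) bags_U(1) by (simp only: Int_assoc Int_absorb1)
        then show ?thesis using est[OF indep_finite[OF i]] by simp
      qed
      also have "val (?I \<inter> bags (nbh x)) \<le> g ?S"
      proof -
        have "?I \<inter> bags (nbh x) \<inter> K = (I \<inter> bags ?U') \<inter> K"
          using bags_U unfolding K' by (simp only: ac_simps Int_absorb1 Int_left_absorb)
        then have "?I \<inter> bags (nbh x) \<inter> K = ?S" unfolding I(2) .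
        moreover have "indep (?I \<inter> bags (nbh x))" by (rule indep_subset[OF i Int_lower1])
        ultimately show ?thesis
          by (intro conjunct2[OF g[OF S], rule_format] Int_lower2)
      qed
      finally show ?thesis by (simp add: est')
    qed
    ultimately show ?thesis unfolding best_def by (intro conjI exI[of _ I] allI impI I(1))
  qed
  then have 1: "\<forall>J. indep J \<longrightarrow> J \<subseteq> bags ?U' \<longrightarrow> best (bags ?U') J (estimate ?R ?par ?f ?base J)"
    by (intro allI impI)
  have 2: "?R \<subseteq> {..<m}" using Rm x by auto
  have 3: "\<forall>y\<in>?R. ?par y < m \<longrightarrow> adj y (?par y)" using par_adj pR(3) x by auto
  have 4: "\<forall>y\<in>?R. \<forall>z. adj y z \<longrightarrow> z \<in> ?R \<or> z = ?par y"
    using closed adj_p x by auto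
  have 5: "\<forall>y\<in>?R. \<forall>z\<in>?R. adj y z \<longrightarrow> ?par y = z \<or> ?par z = y"
  proof (intro ballI impI)
    fix y z assume yz: "y \<in> ?R" "z \<in> ?R" "adj y z"
    have zy: "adj z y" by (rule adj_sym[OF yz(3)])
    consider "y = x" "z = x" | "y = x" "z \<in> R" | "y \<in> R" "z = x" | "y \<in> R" "z \<in> R"
      using yz(1,2) by blast
    then show "?par y = z \<or> ?par z = y"
    proof cases
      case 1 then show ?thesis using yz adj_irrefl by simp
    next
      case 2 then show ?thesis using closed[of z y] zy x(2) by auto
    next
      case 3 then show ?thesis using closed[of y z] yz x(2) by auto
    next
      case 4 then show ?thesis using edge[of y z] yz x(2) by auto
    qed
  qed
  show ?thesis unfolding peeled_def by (rule conjI[OF 2 conjI[OF 3 conjI[OF 4 conjI[OF 5 1]]]])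
qed

end

section \<open>Counting and listing independent sets\<close>

text \<open>A set of at most \<open>j\<close> elements is written into \<open>j\<close> places over
  \<open>n + 1\<close> symbols; the symbol \<open>n\<close>, which is outside \<open>{..<n}\<close>,
  fills the remaining places.\<close>

lemma card_small_subsets:
  "card {A. A \<subseteq> {..<n::nat} \<and> card A \<le> j} \<le> Suc n ^ j"
proof -
  let ?L = "{xs. set xs \<subseteq> {..n} \<and> length xs = j}"
  have "{A. A \<subseteq> {..<n} \<and> card A \<le> j} \<subseteq> (\<lambda>xs. set xs - {n}) ` ?L"
  proof
    fix A assume "A \<in> {A. A \<subseteq> {..<n} \<and> card A \<le> j}"
    then have A: "A \<subseteq> {..<n}" "card A \<le> j" "finite A" by (auto intro: finite_subset)
    let ?xs = "sorted_list_of_set A @ replicate (j - card A) n"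
    have "set ?xs - {n} = A" "?xs \<in> ?L" using A by auto
    then show "A \<in> (\<lambda>xs. set xs - {n}) ` ?L" by blast
  qed
  then have "card {A. A \<subseteq> {..<n} \<and> card A \<le> j} \<le> card ?L"
    by (intro surj_card_le finite_lists_length_eq) auto
  also have "\<dots> = Suc n ^ j" by (simp add: card_lists_length_eq)
  finally show ?thesis .
qed

section \<open>Bounds from width and degree\<close>

context decomposition
begin

text \<open>The minimum in \<open>gamma\<close> is attained because the set of sizes is finite and
  nonempty: every vertex is within any radius of itself, so \<open>verts G\<close> dominates
  \<open>A\<close>.\<close>

lemma gamma_witness:
  assumes "A \<subseteq> verts G"
  obtains D where "dist_dominates r G D A" "card D = gamma r A G" "finite D"
proof -
  let ?S = "{card D | D. dist_dominates r G D A}"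
  have "dist_dominates r G (verts G) A"
    using assms gdist_refl by (auto simp: dist_dominates_def intro!: bexI)
  then have "?S \<noteq> {}" by blast
  moreover have "finite ?S"
  proof (rule finite_subset)
    show "?S \<subseteq> {..n}"
      using card_mono[of "{..<n}"] by (auto simp: dist_dominates_def vG)
  qed simp
  ultimately have "gamma r A G \<in> ?S" unfolding gamma_def by (rule Min_in[rotated])
  then obtain D where "dist_dominates r G D A" "card D = gamma r A G" by auto
  moreover have "finite D" using calculation(1) by (auto simp: dist_dominates_def vG intro: finite_subset)
  ultimately show ?thesis using that by blast
qed

lemma part_subset: "x < m \<Longrightarrow> C x \<subseteq> verts G" and part_nonempty: "x < m \<Longrightarrow> C x \<noteq> {}"
  using tpd vT by (auto simp: tree_partition_decomp_def partition_on_def)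

lemma gamma_le_width: "x < m \<Longrightarrow> gamma \<rho> (C x) G \<le> decomp_width \<rho> G T C"
  unfolding decomp_width_def vT by (intro Max_ge) auto

text \<open>Choosing a vertex in each part embeds the nodes into the vertices. Loops over nodes are
  thereby bounded in terms of \<open>n\<close>.\<close>

lemma nodes: "0 < m" "m \<le> n"
proof -
  show "0 < m" using tpd vT by (auto simp: tree_partition_decomp_def is_tree_def)
  have "\<forall>x\<in>{..<m}. \<exists>v. v \<in> bag x" using part_nonempty by (auto simp: bag_def)
  then obtain h where h: "\<And>x. x < m \<Longrightarrow> h x \<in> bag x" by (metis lessThan_iff)
  have "inj_on h {..<m}" using h bag_disjoint by (auto simp: inj_on_def) metis
  moreover have "h ` {..<m} \<subseteq> {..<n}" using h bag_less by auto
  ultimately have "card {..<m} \<le> card {..<n}" by (intro card_inj_on_le) auto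
  then show "m \<le> n" by simp
qed

text \<open>A nonempty part needs a dominating vertex. This keeps the exponent of the final bound
  positive, so that it also pays for the polynomial overhead.\<close>

lemma width_pos: "0 < decomp_width \<rho> G T C"
proof -
  obtain D where D: "dist_dominates \<rho> G D (C 0)" "card D = gamma \<rho> (C 0) G" "finite D"
    using gamma_witness part_subset nodes(1) by metis
  have "D \<noteq> {}" using D(1) part_nonempty[OF nodes(1)] by (auto simp: dist_dominates_def)
  then have "0 < gamma \<rho> (C 0) G" using D by (metis card_gt_0_iff)
  then show ?thesis using gamma_le_width[OF nodes(1)] by simp
qed

lemma card_indep_bag:
  assumes I: "indep I" and x: "x < m"
  shows "card (I \<inter> bag x) \<le> decomp_width \<rho> G T C"
proof -
  obtain D where D: "dist_dominates \<rho> G D (C x)" "card D = gamma \<rho> (C x) G" "finite D"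
    using gamma_witness part_subset x by metis
  have "\<forall>u\<in>I \<inter> bag x. \<exists>d\<in>D. gdist G u d \<le> enat \<rho>"
    using D(1) by (auto simp: dist_dominates_def bag_def)
  then obtain h where h: "\<And>u. u \<in> I \<inter> bag x \<Longrightarrow> h u \<in> D \<and> gdist G u (h u) \<le> enat \<rho>" by metis
  have "inj_on h (I \<inter> bag x)"
  proof (rule inj_onI)
    fix u v assume uv: "u \<in> I \<inter> bag x" "v \<in> I \<inter> bag x" "h u = h v"
    have "gdist G u v \<le> enat (\<rho> + \<rho>)"
      using gdist_triangle[of G u "h u" \<rho> v \<rho>] h uv gdist_sym[OF G] by metis
    then show "u = v" using indepD[OF I, of u v] uv by (auto simp: mult_2)
  qed
  then have "card (I \<inter> bag x) \<le> card D" using h D(3) by (intro card_inj_on_le) auto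
  then show ?thesis using D(2) gamma_le_width[OF x] by simp
qed

lemma finite_nbh: "finite (nbh x)"
  by (rule finite_subset[of _ "insert x {..<m}"]) (auto simp: nbh_def dest: adj_less)

lemma card_nbh: "x < m \<Longrightarrow> card (nbh x) \<le> Suc (max_degree T)"
proof -
  assume x: "x < m"
  have "degree T x \<le> max_degree T" unfolding max_degree_def vT using x by (intro Max_ge) auto
  moreover have "card (nbh x) \<le> Suc (degree T x)"
    unfolding nbh_def degree_def adj_def by (rule card_insert_le_m1) auto
  ultimately show ?thesis by simp
qed

lemma card_indep_nbh:
  assumes "indep A" "A \<subseteq> bags (nbh x)" "x < m"
  shows "card A \<le> Suc (max_degree T) * decomp_width \<rho> G T C"
proof -
  have "A = (\<Union>y\<in>nbh x. A \<inter> bag y)" using assms by auto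
  then have "card A \<le> (\<Sum>y\<in>nbh x. card (A \<inter> bag y))"
    using card_UN_le[OF finite_nbh] by metis
  also have "\<dots> \<le> (\<Sum>y\<in>nbh x. decomp_width \<rho> G T C)"
  proof (rule sum_mono)
    fix y assume "y \<in> nbh x"
    then have "y < m" using assms by (auto simp: nbh_def dest: adj_less)
    then show "card (A \<inter> bag y) \<le> decomp_width \<rho> G T C" using card_indep_bag assms by blast
  qed
  also have "\<dots> = card (nbh x) * decomp_width \<rho> G T C" by simp
  also have "\<dots> \<le> Suc (max_degree T) * decomp_width \<rho> G T C"
    using card_nbh[OF assms(3)] by (rule mult_right_mono) simp
  finally show ?thesis .
qed

text \<open>For \<open>n\<close> at least 2 the bound \<open>Suc n ^ (Suc d * k)\<close> is turned
  into a power of \<open>n\<close> by \<open>Suc n \<le> n ^ 2\<close> and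
  \<open>Suc d \<le> 2 * d\<close>; hence the 4. The factor 2 is for \<open>n = 1\<close>, where
  every power of \<open>n\<close> is 1 but the ground set has two subsets.\<close>

lemma card_indep_sets:
  assumes x: "x < m" and k: "decomp_width \<rho> G T C \<le> k" and d: "max_degree T \<le> d" "0 < d"
  shows "card {A. A \<subseteq> bags (nbh x) \<and> indep A} \<le> 2 * n ^ (4 * d * k)"
proof -
  let ?F = "{A. A \<subseteq> bags (nbh x) \<and> indep A}"
  have n: "n \<noteq> 0" using nodes by simp
  show ?thesis
  proof (cases "n = 1")
    case True
    have "card ?F \<le> card (Pow {..<n})"
      using indep_less by (intro card_mono) auto
    then show ?thesis using True by (simp add: card_Pow)
  next
    case False
    let ?j = "Suc d * k"
    have "?F \<subseteq> {A. A \<subseteq> {..<n} \<and> card A \<le> ?j}"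
    proof (rule subsetI, rule CollectI, rule conjI)
      fix A assume A: "A \<in> ?F"
      then show "A \<subseteq> {..<n}" using indep_less by blast
      have "card A \<le> Suc (max_degree T) * decomp_width \<rho> G T C" using A card_indep_nbh x by blast
      also have "\<dots> \<le> ?j" using k d by (intro mult_mono) auto
      finally show "card A \<le> ?j" .
    qed
    then have "card ?F \<le> card {A. A \<subseteq> {..<n} \<and> card A \<le> ?j}"
      by (intro card_mono) (auto intro: finite_subset[of _ "Pow {..<n}"])
    also have "\<dots> \<le> Suc n ^ ?j" by (rule card_small_subsets)
    also have "\<dots> \<le> (n ^ 2) ^ ?j"
    proof (rule power_mono)
      have "n + n \<le> n * n" using n False by (cases n) auto
      then show "Suc n \<le> n ^ 2" using n unfolding power2_eq_square by linarith
    qed simp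
    also have "\<dots> = n ^ (2 * ?j)" by (simp only: power_mult)
    also have "\<dots> \<le> n ^ (4 * d * k)"
    proof (rule power_increasing)
      have "Suc d * k \<le> (2 * d) * k" using d(2) by (intro mult_right_mono) auto
      then show "2 * ?j \<le> 4 * d * k" by simp
    qed (use n in simp)
    finally show ?thesis by simp
  qed
qed

section \<open>Listing the independent sets\<close>

definition compat where "compat A v \<longleftrightarrow> (\<forall>u\<in>A. \<not> gdist G u v \<le> enat (2 * \<rho>))"

text \<open>Sets containing \<open>v\<close> are appended behind those without it. Hence each stage
  is a prefix of the next, so the program can extend the list in place, and every nonempty set comes
  after the set obtained by deleting its largest vertex.\<close>

fun indep_list :: "nat set \<Rightarrow> nat \<Rightarrow> nat set list" where
  "indep_list X 0 = [{}]"
| "indep_list X (Suc v) = indep_list X v @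
     (if v \<in> X then map (insert v) (filter (\<lambda>A. compat A v) (indep_list X v)) else [])"

lemma indep_insert:
  assumes "v < n" "v \<notin> A"
  shows "indep (insert v A) \<longleftrightarrow> indep A \<and> compat A v"
proof
  assume I: "indep (insert v A)"
  have "indep A" by (rule indep_subset[OF I]) auto
  moreover have "compat A v"
    using indepD[OF I] assms(2) unfolding compat_def by (metis insertI1 insertI2)
  ultimately show "indep A \<and> compat A v" by blast
next
  assume A: "indep A \<and> compat A v"
  then have "\<not> gdist G u v \<le> enat (2 * \<rho>) \<and> \<not> gdist G v u \<le> enat (2 * \<rho>)" if "u \<in> A" for u
    using that gdist_sym[OF G, of v u] unfolding compat_def by metis
  then show "indep (insert v A)"
    using A assms(1) unfolding dist_indep_def vG not_le by blast
qed

lemma set_indep_list: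
  "v \<le> n \<Longrightarrow> set (indep_list X v) = {A. A \<subseteq> X \<inter> {..<v} \<and> indep A}"
proof (induction v)
  case 0
  have "indep {}" by (simp add: dist_indep_def)
  then show ?case by auto
next
  case (Suc v)
  let ?F = "{A. A \<subseteq> X \<inter> {..<v} \<and> indep A}"
  have sub: "A \<subseteq> X \<inter> {..<Suc v} \<longleftrightarrow> A \<subseteq> X \<inter> {..<v} \<or> (v \<in> X \<and> v \<in> A \<and> A - {v} \<subseteq> X \<inter> {..<v})" for A
    unfolding lessThan_Suc by blast
  have ins: "insert v ` {A \<in> ?F. compat A v} = {A. v \<in> A \<and> A - {v} \<subseteq> X \<inter> {..<v} \<and> indep A}"
  proof (intro subset_antisym subsetI)
    fix A assume "A \<in> insert v ` {A \<in> ?F. compat A v}"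
    then obtain A' where A': "A = insert v A'" "A' \<subseteq> X \<inter> {..<v}" "indep A'" "compat A' v" by auto
    moreover have "v \<notin> A'" using A' by auto
    ultimately show "A \<in> {A. v \<in> A \<and> A - {v} \<subseteq> X \<inter> {..<v} \<and> indep A}"
      using indep_insert[of v A'] Suc.prems by auto
  next
    fix A assume A: "A \<in> {A. v \<in> A \<and> A - {v} \<subseteq> X \<inter> {..<v} \<and> indep A}"
    then have "insert v (A - {v}) = A" by auto
    then show "A \<in> insert v ` {A \<in> ?F. compat A v}"
      using A indep_insert[of v "A - {v}"] Suc.prems by (intro image_eqI[of _ _ "A - {v}"]) auto
  qed
  have IH: "set (indep_list X v) = ?F" using Suc by simp
  show ?case
  proof (cases "v \<in> X")
    case True
    then have "set (indep_list X (Suc v)) = ?F \<union> insert v ` {A \<in> ?F. compat A v}"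
      using IH by simp
    also have "\<dots> = {A. A \<subseteq> X \<inter> {..<Suc v} \<and> indep A}"
      unfolding ins sub using True by auto
    finally show ?thesis .
  next
    case False
    then show ?thesis using IH unfolding sub by simp
  qed
qed

text \<open>Sets appended for \<open>v\<close> differ from the earlier ones by containing
  \<open>v\<close>. Without repetitions the length of the list is the number of independent sets, to
  which the counting bound applies.\<close>

lemma distinct_indep_list: "v \<le> n \<Longrightarrow> distinct (indep_list X v)"
proof (induction v)
  case (Suc v)
  have notin: "v \<notin> A" if "A \<in> set (indep_list X v)" for A
    using that Suc.prems set_indep_list[of v X] by auto
  have "inj_on (insert v) (set (indep_list X v))"
    using notin by (intro inj_onI) (metis Diff_insert_absorb)
  then show ?case
    using Suc notin by (auto simp: distinct_map intro: inj_on_subset)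
qed simp

lemma length_indep_list:
  assumes "v \<le> n"
  shows "length (indep_list X v) \<le> card {A. A \<subseteq> X \<and> indep A}"
proof -
  have "length (indep_list X v) = card (set (indep_list X v))"
    using distinct_indep_list[OF assms] by (simp add: distinct_card)
  also have "\<dots> \<le> card {A. A \<subseteq> X \<and> indep A}"
    unfolding set_indep_list[OF assms]
    by (rule card_mono) (auto intro: finite_subset[of _ "Pow {..<n}"] dest: indep_less)
  finally show ?thesis .
qed

end

section \<open>Reading the instance\<close>

lemma row_index_less: "i < a \<Longrightarrow> j < b \<Longrightarrow> i * b + j < a * (b::nat)"
proof -
  assume "i < a" "j < b"
  then have "i * b + j < Suc i * b" by simp
  also have "\<dots> \<le> a * b" using \<open>i < a\<close> by (intro mult_right_mono) auto
  finally show ?thesis .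
qed

lemma runs_Seq':
  assumes "runs B p s R" "\<And>s'. R s' \<Longrightarrow> frame (wregs p) (warrs p) s s' \<Longrightarrow> runs B q s' Q"
  shows "runs B (Seq p q) s Q"
  using assms by (intro runs_Seq) (blast intro: runs_mono)

lemma length_matrix_list [simp]: "length (matrix_list a b R) = a * b"
  by (induction a) (auto simp: matrix_list_def)

lemma nth_matrix_list: "i < a \<Longrightarrow> j < b \<Longrightarrow> matrix_list a b R ! (i * b + j) = of_bool (R i j)"
proof (induction a)
  case (Suc a)
  have app: "matrix_list (Suc a) b R = matrix_list a b R @ map (\<lambda>j. of_bool (R a j)) [0..<b]"
    by (simp add: matrix_list_def)
  show ?case
  proof (cases "i < a")
    case True
    then have "i * b + j < a * b" using Suc.prems row_index_less by simp
    then show ?thesis using True Suc by (simp add: app nth_append)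
  next
    case False
    then show ?thesis using Suc.prems by (simp add: app nth_append less_Suc_eq)
  qed
qed simp

text \<open>Register 0 gets no name: it is the result register and holds \<open>base\<close>
  throughout the peeling.\<close>

abbreviation (input) "rN \<equiv> 23 :: nat"
abbreviation (input) "rM \<equiv> 2 :: nat"
abbreviation (input) "rR \<equiv> 3 :: nat"
abbreviation (input) "rT \<equiv> 4 :: nat"
abbreviation (input) "rC \<equiv> 5 :: nat"
abbreviation (input) "rI \<equiv> 6 :: nat"
abbreviation (input) "rS \<equiv> 7 :: nat"
abbreviation (input) "rV \<equiv> 8 :: nat"
abbreviation (input) "rJ \<equiv> 9 :: nat"
abbreviation (input) "rW \<equiv> 10 :: nat"
abbreviation (input) "rX \<equiv> 11 :: nat"
abbreviation (input) "rP \<equiv> 12 :: nat"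
abbreviation (input) "rY \<equiv> 13 :: nat"
abbreviation (input) "rZ \<equiv> 14 :: nat"
abbreviation (input) "rQ \<equiv> 15 :: nat"
abbreviation (input) "rBad \<equiv> 16 :: nat"
abbreviation (input) "rLen \<equiv> 17 :: nat"
abbreviation (input) "rOld \<equiv> 18 :: nat"
abbreviation (input) "rIn \<equiv> 19 :: nat"
abbreviation (input) "rL \<equiv> 20 :: nat"
abbreviation (input) "rA \<equiv> 21 :: nat"
abbreviation (input) "rIt \<equiv> 22 :: nat"

abbreviation (input) "aIn \<equiv> 0 :: nat"
abbreviation (input) "aMn \<equiv> 13 :: nat"
abbreviation (input) "aMm \<equiv> 2 :: nat"
abbreviation (input) "aPow \<equiv> 3 :: nat"
abbreviation (input) "aRem \<equiv> 4 :: nat"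
abbreviation (input) "aBall \<equiv> 5 :: nat"
abbreviation (input) "aNext \<equiv> 6 :: nat"
abbreviation (input) "aPar \<equiv> 7 :: nat"
abbreviation (input) "aLast \<equiv> 8 :: nat"
abbreviation (input) "aOk \<equiv> 9 :: nat"
abbreviation (input) "aKey \<equiv> 10 :: nat"
abbreviation (input) "aVal \<equiv> 11 :: nat"
abbreviation (input) "aF \<equiv> 12 :: nat"

abbreviation edgeE :: "nat \<Rightarrow> nat \<Rightarrow> aexp" where
  "edgeE u v \<equiv> Elem aIn (Plus (Const 3) (Plus (Elem aMn (Var u)) (Var v)))"

abbreviation adjE :: "nat \<Rightarrow> nat \<Rightarrow> aexp" where
  "adjE x y \<equiv> Elem aIn (Plus (Var rT) (Plus (Elem aMm (Var x)) (Var y)))"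

abbreviation incE :: "nat \<Rightarrow> nat \<Rightarrow> aexp" where
  "incE x v \<equiv> Elem aIn (Plus (Var rC) (Plus (Elem aMn (Var x)) (Var v)))"

abbreviation seq :: "com \<Rightarrow> com \<Rightarrow> com" (infixr ";;" 60) where
  "p ;; q \<equiv> Seq p q"

text \<open>The machine has no multiplication, so the row offsets \<open>i * n\<close> and
  \<open>i * m\<close> and the powers of 2 are tabulated by repeated addition. \<open>rT\<close> and
  \<open>rC\<close> are the positions of the tree matrix and of the incidence matrix. Capping
  \<open>rR\<close> at \<open>n * n\<close> keeps the number of search rounds polynomial in
  \<open>n\<close> for every \<rho>.\<close>

definition setup_prog :: com where
  "setup_prog =
     Assign rN (Elem aIn (Const 0)) ;;
     Assign rM (Elem aIn (Const 1)) ;;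
     For rI rN (Store aMn (Plus (Var rI) (Const 1)) (Plus (Elem aMn (Var rI)) (Var rN))) ;;
     For rI rM (Store aMm (Plus (Var rI) (Const 1)) (Plus (Elem aMm (Var rI)) (Var rM))) ;;
     Assign rS (Plus (Var rN) (Var rM)) ;;
     Store aPow (Const 0) (Const 1) ;;
     For rI rS (Store aPow (Plus (Var rI) (Const 1)) (Plus (Elem aPow (Var rI)) (Elem aPow (Var rI)))) ;;
     Assign rT (Plus (Const 3) (Elem aMn (Var rN))) ;;
     Assign rC (Plus (Var rT) (Elem aMm (Var rM))) ;;
     Assign rR (Plus (Elem aIn (Const 2)) (Elem aIn (Const 2))) ;;
     Cond (Less (Elem aMn (Var rN)) (Var rR)) (Assign rR (Elem aMn (Var rN))) Skip"

lemmas runs_intros = runs_Seq runs_Cond runs_Assign runs_Store runs_Skip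

context decomposition
begin

text \<open>Row \<open>m\<close> of the incidence matrix lies behind the input and hence reads as the empty bag; the
  program uses the node \<open>m\<close> as a missing parent.\<close>

definition static :: "state \<Rightarrow> bool" where
  "static s \<longleftrightarrow> regs s rN = n \<and> regs s rM = m \<and> regs s rR = min (2 * \<rho>) (n * n) \<and>
     (\<forall>u<n. \<forall>v<n. arrs s aIn (3 + (arrs s aMn u + v)) = of_bool ((u, v) \<in> edges G)) \<and>
     (\<forall>x<m. \<forall>y<m. arrs s aIn (regs s rT + (arrs s aMm x + y)) = of_bool (adj x y)) \<and>
     (\<forall>x\<le>m. \<forall>v<n. arrs s aIn (regs s rC + (arrs s aMn x + v)) = of_bool (v \<in> bag x)) \<and>
     (\<forall>i\<le>n + m. arrs s aPow i = 2 ^ i)"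

lemma static_frame:
  assumes "static s" "frame X Y s s'" "X \<inter> {rM, rR, rT, rC, rN} = {}" "Y \<inter> {aIn, aMm, aPow, aMn} = {}"
  shows "static s'"
proof -
  have "regs s' x = regs s x" if "x \<in> {rM, rR, rT, rC, rN}" for x
    using assms that by (auto simp: frame_def)
  moreover have "arrs s' a = arrs s a" if "a \<in> {aIn, aMm, aPow, aMn}" for a
    using assms that by (auto simp: frame_def)
  ultimately show ?thesis using assms(1) unfolding static_def by auto
qed

lemma staticD:
  assumes "static s"
  shows "regs s rN = n" "regs s rM = m" "regs s rR = min (2 * \<rho>) (n * n)"
    "\<And>u v. u < n \<Longrightarrow> v < n \<Longrightarrow> arrs s aIn (3 + (arrs s aMn u + v)) = of_bool ((u, v) \<in> edges G)"
    "\<And>x y. x < m \<Longrightarrow> y < m \<Longrightarrow> arrs s aIn (regs s rT + (arrs s aMm x + y)) = of_bool (adj x y)"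
    "\<And>x v. x \<le> m \<Longrightarrow> v < n \<Longrightarrow> arrs s aIn (regs s rC + (arrs s aMn x + v)) = of_bool (v \<in> bag x)"
    "\<And>i. i \<le> n + m \<Longrightarrow> arrs s aPow i = 2 ^ i"
  using assms by (auto simp: static_def)

lemma encode_nth:
  defines "xs \<equiv> encode_instance n m \<rho> G T C"
  shows "xs ! 0 = n" "xs ! 1 = m" "xs ! 2 = \<rho>"
    "length xs = 3 + n * n + m * m + m * n"
    "\<And>u v. u < n \<Longrightarrow> v < n \<Longrightarrow> xs ! (3 + (u * n + v)) = of_bool ((u, v) \<in> edges G)"
    "\<And>x y. x < m \<Longrightarrow> y < m \<Longrightarrow> xs ! (3 + n * n + (x * m + y)) = of_bool (adj x y)"
    "\<And>x v. x < m \<Longrightarrow> v < n \<Longrightarrow> xs ! (3 + n * n + m * m + (x * n + v)) = of_bool (v \<in> bag x)"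
proof -
  show "xs ! 0 = n" "xs ! 1 = m" "xs ! 2 = \<rho>" "length xs = 3 + n * n + m * m + m * n"
    by (auto simp: xs_def encode_instance_def)
  show "xs ! (3 + (u * n + v)) = of_bool ((u, v) \<in> edges G)" if "u < n" "v < n" for u v
    using that row_index_less[of u n v n] by (simp add: xs_def encode_instance_def nth_append nth_matrix_list)
  show "xs ! (3 + n * n + (x * m + y)) = of_bool (adj x y)" if "x < m" "y < m" for x y
    using that row_index_less[of x m y m]
    by (simp add: xs_def encode_instance_def nth_append nth_matrix_list adj_def)
  show "xs ! (3 + n * n + m * m + (x * n + v)) = of_bool (v \<in> bag x)" if "x < m" "v < n" for x v
    using that row_index_less[of x m v n]
    by (simp add: xs_def encode_instance_def nth_append nth_matrix_list bag_def)
qed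

lemma runs_table:
  assumes "k \<noteq> rI" "regs s k \<le> B" "arrs s X 0 = F 0"
    and "\<And>s' j. \<lbrakk>frame {rI} {X} s s'; regs s' rI = j; arrs s' X j = F j\<rbrakk> \<Longrightarrow> aval e s' = F (Suc j)"
  shows "runs B (For rI k (Store X (Plus (Var rI) (Const 1)) e)) s (\<lambda>s'. \<forall>i\<le>regs s k. arrs s' X i = F i)"
proof (rule runs_For[where I = "\<lambda>j s'. \<forall>i\<le>j. arrs s' X i = F i"])
  fix j s'
  assume *: "j < regs s k" "regs s' rI = j" "\<forall>i\<le>j. arrs s' X i = F i"
    "frame (insert rI (wregs (Store X (Plus (Var rI) (Const 1)) e)))
      (warrs (Store X (Plus (Var rI) (Const 1)) e)) s s'"
  then have "aval e s' = F (Suc j)" using assms(4) by auto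
  then show "runs B (Store X (Plus (Var rI) (Const 1)) e) s'
      (\<lambda>s''. \<forall>i\<le>Suc j. arrs (s''\<lparr>regs := (regs s'')(rI := Suc j)\<rparr>) X i = F i)"
    using * by (intro runs_Store) (auto simp: le_Suc_eq)
qed (use assms in auto)

lemma runs_setup:
  assumes "n + m \<le> B"
  shows "runs B setup_prog (init_state (encode_instance n m \<rho> G T C))
     (\<lambda>s. static s \<and> regs s 0 = 0 \<and> (\<forall>a\<in>{aRem..aF}. \<forall>i. arrs s a i = 0))"
proof -
  let ?xs = "encode_instance n m \<rho> G T C"
  let ?s0 = "init_state ?xs"
  define D where "D i = (if i < length ?xs then ?xs ! i else 0)" for i
  have D: "arrs ?s0 aIn = D" by (auto simp: D_def init_state_def)
  define base where "base s \<longleftrightarrow> regs s rN = n \<and> regs s rM = m \<and> regs s 0 = 0 \<and> arrs s aIn = D \<and>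
     (\<forall>a\<in>{aRem..aF}. \<forall>i. arrs s a i = 0)" for s :: state
  note enc = encode_nth encode_nth(2)[unfolded One_nat_def]
  have D012: "D 0 = n" "D (Suc 0) = m" "D 2 = \<rho>" by (simp_all add: D_def enc)
  have s0: "arrs ?s0 a i = (if a = aIn then D i else 0)" "regs ?s0 x = 0" for a i x
    by (auto simp: init_state_def D_def)
  show ?thesis
    unfolding setup_prog_def
    apply (rule runs_Seq, rule runs_Assign, rule runs_Seq, rule runs_Assign)
    apply (rule runs_Seq'[OF runs_table[where F = "\<lambda>i. i * n"]])
        apply (use assms in \<open>simp_all add: s0 D012 frame_def\<close>)[4]
    subgoal premises p for s1
    proof -
      have s1: "base s1" "\<forall>i\<le>n. arrs s1 aMn i = i * n" and m1: "arrs s1 aMm 0 = 0"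
        using p nodes by (simp_all add: s0 D D012 frame_def base_def)
      show ?thesis
        apply (rule runs_Seq'[OF runs_table[where F = "\<lambda>i. i * m"]])
            apply (use assms s1 m1 in \<open>simp_all add: base_def frame_def\<close>)[4]
        subgoal premises p for s2
        proof -
          have s2: "base s2" "\<forall>i\<le>n. arrs s2 aMn i = i * n" "\<forall>i\<le>m. arrs s2 aMm i = i * m"
            using p s1 by (simp_all add: frame_def base_def)
          show ?thesis
            apply (rule runs_Seq, rule runs_Assign, rule runs_Seq, rule runs_Store)
            apply (rule runs_Seq'[OF runs_table[where F = "\<lambda>i. 2 ^ i"]])
                apply (use assms s2 in \<open>simp_all add: base_def frame_def\<close>)[4]
            subgoal premises p for s3
            proof -
              have s3: "base s3" "\<forall>i\<le>n. arrs s3 aMn i = i * n" "\<forall>i\<le>m. arrs s3 aMm i = i * m"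
                "\<forall>i\<le>n + m. arrs s3 aPow i = 2 ^ i"
                using p s2 by (simp_all add: frame_def base_def)
              have b: "regs s3 rN = n" "regs s3 rM = m" "regs s3 0 = 0" "arrs s3 aIn = D"
                "\<And>a i. a \<in> {aRem..aF} \<Longrightarrow> arrs s3 a i = 0"
                using s3 by (auto simp: base_def)
              have tab: "\<And>i. i \<le> n \<Longrightarrow> arrs s3 aMn i = i * n" "\<And>i. i \<le> m \<Longrightarrow> arrs s3 aMm i = i * m"
                "\<And>i. i \<le> n + m \<Longrightarrow> arrs s3 aPow i = 2 ^ i"
                using s3 by auto
              have inc: "D (3 + n * n + m * m + (x * n + v)) = of_bool (v \<in> bag x)"
                if "x \<le> m" "v < n" for x v
              proof (cases "x = m")
                case True
                then show ?thesis by (simp add: D_def enc(4) bag_def)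
              next
                case False
                then show ?thesis
                  using that row_index_less[of x m v n] by (simp add: D_def enc(4,7))
              qed
              have edge: "D (3 + (u * n + v)) = of_bool ((u, v) \<in> edges G)"
                if "u < n" "v < n" for u v
                using that row_index_less[of u n v n] by (simp add: D_def enc(4,5))
              have adj: "D (3 + n * n + (x * m + y)) = of_bool (adj x y)"
                if "x < m" "y < m" for x y
                using that row_index_less[of x m y m] by (simp add: D_def enc(4,6))
              have fin: "static s' \<and> regs s' 0 = 0 \<and> (\<forall>a\<in>{aRem..aF}. \<forall>i. arrs s' a i = 0)"
                if *: "frame {rT, rC, rR} {} s3 s'" "regs s' rT = 3 + n * n"
                  "regs s' rC = 3 + n * n + m * m" "regs s' rR = min (2 * \<rho>) (n * n)"
                for s'
              proof -
                from *  have "arrs s' a = arrs s3 a" for a by (simp add: frame_def)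
                moreover have "regs s' rN = n" "regs s' rM = m" "regs s' 0 = 0"
                  using *(1) b by (auto simp: frame_def)
                ultimately show "static s' \<and> regs s' 0 = 0 \<and> (\<forall>a\<in>{aRem..aF}. \<forall>i. arrs s' a i = 0)"
                  using *(2-4) edge adj inc tab b(4,5) nodes(2) unfolding static_def by simp
              qed
              show ?thesis
                by (intro runs_intros; rule fin; use b tab D012 in \<open>simp add: frame_def\<close>)
            qed
            done
        qed
        done
    qed
    done
qed

end

section \<open>Enumeration of independent sets\<close>

text \<open>One round of breadth-first search. The result goes to a second array, since updating
  \<open>aBall\<close> in place could let a vertex spread further within the same round and the
  radius would grow by more than one.\<close>

definition expand_prog :: com where
  "expand_prog =
     For rI rN
      (Store aNext (Var rI) (Elem aBall (Var rI)) ;;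
       For rW rN
        (Cond (Conj (Less (Const 0) (edgeE rI rW)) (Less (Const 0) (Elem aBall (Var rW))))
          (Store aNext (Var rI) (Const 1)) Skip))"

definition ball_prog :: com where
  "ball_prog =
     For rI rN (Store aBall (Var rI) (Const 0)) ;;
     Store aBall (Var rV) (Const 1) ;;
     For rJ rR (expand_prog ;; For rI rN (Store aBall (Var rI) (Elem aNext (Var rI))))"

lemma expand_writes [simp]: "wregs expand_prog = {rI, rW}" "warrs expand_prog = {aNext}"
  by (auto simp: expand_prog_def)

lemma ball_writes [simp]: "wregs ball_prog = {rI, rJ, rW}" "warrs ball_prog = {aBall, aNext}"
  by (auto simp: ball_prog_def)

context decomposition
begin

lemma runs_expand:
  assumes st: "static s" and B: "n \<le> B"
  shows "runs B expand_prog s (\<lambda>s'. \<forall>u<n. arrs s' aNext u \<noteq> 0 \<longleftrightarrow>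
     arrs s aBall u \<noteq> 0 \<or> (\<exists>w<n. (u, w) \<in> edges G \<and> arrs s aBall w \<noteq> 0))"
  unfolding expand_prog_def
proof (rule runs_For[where I = "\<lambda>j s'. \<forall>u<j. arrs s' aNext u \<noteq> 0 \<longleftrightarrow>
     arrs s aBall u \<noteq> 0 \<or> (\<exists>w<n. (u, w) \<in> edges G \<and> arrs s aBall w \<noteq> 0)"], goal_cases)
  case (6 j s1)
  then have fr1: "frame {rI, rW} {aNext} s s1" by (auto simp: frame_def)
  have st1: "static s1" using static_frame[OF st fr1] by simp
  have j: "j < n" using 6(1) st by (simp add: static_def)
  let ?s = "s1\<lparr>arrs := (arrs s1)(aNext := (arrs s1 aNext)(j := arrs s aBall j))\<rparr>"
  have "runs B (For rW rN
        (Cond (Conj (Less (Const 0) (edgeE rI rW)) (Less (Const 0) (Elem aBall (Var rW))))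
          (Store aNext (Var rI) (Const 1)) Skip)) ?s
     (\<lambda>s'. \<forall>u<Suc j. arrs s' aNext u \<noteq> 0 \<longleftrightarrow>
     arrs s aBall u \<noteq> 0 \<or> (\<exists>w<n. (u, w) \<in> edges G \<and> arrs s aBall w \<noteq> 0))"
  proof (rule runs_For[where I = "\<lambda>l s'. (\<forall>u<j. arrs s' aNext u = arrs s1 aNext u) \<and>
       (arrs s' aNext j \<noteq> 0 \<longleftrightarrow>
         arrs s aBall j \<noteq> 0 \<or> (\<exists>w<l. (j, w) \<in> edges G \<and> arrs s aBall w \<noteq> 0))"], goal_cases)
    case (6 l s2)
    then have fr2: "frame {rW} {aNext} s1 s2" by (auto simp: frame_def)
    have st2: "static s2" using static_frame[OF st1 fr2] by simp
    have "l < n" using 6(1) st1 by (simp add: staticD)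
    have "regs s2 rI = j" "arrs s2 aBall = arrs s aBall" "regs s2 rW = l"
      using fr1 fr2 6(2) \<open>regs s1 rI = j\<close> by (auto simp: frame_def)
    then show ?case
      using 6(3) j \<open>l < n\<close> staticD(4)[OF st2, of j l]
      by (intro runs_intros) (auto simp: less_Suc_eq)
  next
    case (7 s2)
    then show ?case using 6(3) st1 j by (auto simp: staticD less_Suc_eq)
  qed (use st1 B in \<open>auto simp: staticD\<close>)
  then show ?case
    using 6(2) fr1 by (intro runs_Seq runs_Store) (simp add: frame_def)
qed (use st B in \<open>auto simp: staticD\<close>)

definition near where "near r u v \<longleftrightarrow> (\<exists>l\<le>r. (u, v) \<in> edges G ^^ l)"

lemma near_mono: "near r u v \<Longrightarrow> r \<le> r' \<Longrightarrow> near r' u v"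
  unfolding near_def by (meson order_trans)

lemma near_0: "near 0 u v \<longleftrightarrow> u = v"
  by (auto simp: near_def)

lemma near_Suc: "near (Suc r) u v \<longleftrightarrow> near r u v \<or> (\<exists>w<n. (u, w) \<in> edges G \<and> near r w v)"
proof
  assume "near (Suc r) u v"
  then obtain l where l: "l \<le> Suc r" "(u, v) \<in> edges G ^^ l" by (auto simp: near_def)
  show "near r u v \<or> (\<exists>w<n. (u, w) \<in> edges G \<and> near r w v)"
  proof (cases l)
    case 0
    then show ?thesis using l by (auto simp: near_def)
  next
    case (Suc l')
    then obtain w where w: "(u, w) \<in> edges G" "(w, v) \<in> edges G ^^ l'"
      using l(2) relpow_Suc_E2 by metis
    moreover have "w < n" using w(1) G vG by (auto simp: simple_graph_def)
    ultimately show ?thesis using Suc l(1) by (auto simp: near_def)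
  qed
next
  assume "near r u v \<or> (\<exists>w<n. (u, w) \<in> edges G \<and> near r w v)"
  then show "near (Suc r) u v"
    unfolding near_def using relpow_Suc_I2 le_SucI Suc_le_mono by metis
qed

text \<open>Vertices joined by some walk are joined by a walk with at most as many steps as
  \<open>edges G\<close> has pairs, which is at most \<open>n * n\<close>. This justifies the cap on
  the radius.\<close>

lemma near_bounded: "near (min (2 * \<rho>) (n * n)) u v \<longleftrightarrow> gdist G u v \<le> enat (2 * \<rho>)"
proof (cases "2 * \<rho> \<le> n * n")
  case True
  then show ?thesis by (simp add: near_def gdist_le_iff)
next
  case False
  have sub: "edges G \<subseteq> {..<n} \<times> {..<n}" using G vG by (auto simp: simple_graph_def)
  then have fin: "finite (edges G)" by (rule finite_subset) simp
  have "card (edges G) \<le> card ({..<n} \<times> {..<n})" using sub by (intro card_mono) auto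
  then have card: "card (edges G) \<le> n * n" by simp
  have "near (n * n) u v" if "(u, v) \<in> edges G ^^ l" for l
    using relpow_finite_bounded[OF fin, of l] that card unfolding near_def
    by (auto intro: order_trans)
  then have "near (2 * \<rho>) u v \<longleftrightarrow> near (n * n) u v"
    using False near_mono[of "n * n" u v "2 * \<rho>"] by (auto simp: near_def)
  then show ?thesis using False by (simp add: near_def gdist_le_iff min_def)
qed

lemma runs_ball:
  assumes st: "static s" and v: "regs s rV = v" "v < n" and B: "n * n \<le> B"
  shows "runs B ball_prog s (\<lambda>s'. \<forall>u<n. arrs s' aBall u = 0 \<longleftrightarrow> \<not> gdist G u v \<le> enat (2 * \<rho>))"
proof -
  have B': "n \<le> B" using B v(2) by (meson le_square order_trans)
  have copy: "runs B (For rI rN (Store aBall (Var rI) e)) s1 (\<lambda>s'. \<forall>u<n. arrs s' aBall u = f u)"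
    if "static s1" and e: "\<And>u s'. u < n \<Longrightarrow> regs s' rI = u \<Longrightarrow> frame {rI} {aBall} s1 s' \<Longrightarrow> aval e s' = f u"
    for s1 e f
    using that B'
    by (intro runs_For[where I = "\<lambda>j s'. \<forall>u<j. arrs s' aBall u = f u"] runs_Store)
      (auto simp: staticD less_Suc_eq)
  show ?thesis unfolding ball_prog_def
  proof (rule runs_Seq'[OF copy[where f = "\<lambda>_. 0"]], goal_cases)
    case (3 s1)
    then have fr1: "frame {rI} {aBall} s s1" by simp
    have st1: "static s1" using static_frame[OF st fr1] by simp
    let ?s = "s1\<lparr>arrs := (arrs s1)(aBall := (arrs s1 aBall)(v := 1))\<rparr>"
    have "runs B (For rJ rR (expand_prog ;; For rI rN (Store aBall (Var rI) (Elem aNext (Var rI))))) ?s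
      (\<lambda>s'. \<forall>u<n. arrs s' aBall u = 0 \<longleftrightarrow> \<not> gdist G u v \<le> enat (2 * \<rho>))"
    proof (rule runs_For[where I = "\<lambda>r s'. \<forall>u<n. arrs s' aBall u = 0 \<longleftrightarrow> \<not> near r u v"], goal_cases)
      case 5
      then show ?case using 3(1) by (auto simp: near_0)
    next
      case (6 r s2)
      then have fr2: "frame {rI, rJ, rW} {aBall, aNext} s1 s2" by (auto simp: frame_def)
      have st2: "static s2" using static_frame[OF st1 fr2] by simp
      show ?case
      proof (rule runs_Seq'[OF runs_expand[OF st2 B']], goal_cases)
        case (1 s3)
        then have st3: "static s3" using static_frame[OF st2] by simp
        have ball: "0 < arrs s2 aBall u \<longleftrightarrow> near r u v" if "u < n" for u
          using 6(3) that by auto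
        have "0 < arrs s3 aNext u \<longleftrightarrow> near (Suc r) u v" if "u < n" for u
          using 1(1) that ball by (simp add: near_Suc cong: conj_cong)
        then have *: "arrs s3 aNext u = 0 \<longleftrightarrow> \<not> near (Suc r) u v" if "u < n" for u
          using that by (metis neq0_conv)
        show ?case
          by (rule runs_mono[OF copy[OF st3, where f = "arrs s3 aNext"]])
            (use * in \<open>auto simp: frame_def\<close>)
      qed
    next
      case (7 s2)
      then show ?case using st1 near_bounded by (auto simp: staticD)
    qed (use st1 B in \<open>auto simp: staticD\<close>)
    then show ?case using fr1 v by (intro runs_Seq runs_Store) (simp add: frame_def)
  qed (use st in auto)
qed

end

text \<open>\<open>compat (insert l A) v\<close> holds iff \<open>compat A v\<close> holds and
  \<open>l\<close> is outside the ball around \<open>v\<close>, so one flag at the pointer and one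
  lookup decide each entry. \<open>rOld\<close> freezes the length: the entries appended now contain
  \<open>v\<close> and must not be extended again.\<close>

definition extend_prog :: com where
  "extend_prog =
     Assign rOld (Var rLen) ;;
     For rI rOld
      (Cond (Equal (Var rI) (Const 0)) (Store aOk (Var rI) (Const 1))
        (Cond (Conj (Less (Const 0) (Elem aOk (Elem aPar (Var rI))))
                    (Equal (Elem aBall (Elem aLast (Var rI))) (Const 0)))
          (Store aOk (Var rI) (Const 1)) (Store aOk (Var rI) (Const 0))) ;;
       Cond (Less (Const 0) (Elem aOk (Var rI)))
        (Store aPar (Var rLen) (Var rI) ;; Store aLast (Var rLen) (Var rV) ;;
         Assign rLen (Plus (Var rLen) (Const 1))) Skip)"

text \<open>Conditions have no disjunction; the negated conjunction tests whether \<open>rY\<close>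
  equals \<open>rX\<close> or is adjacent to it. Thus \<open>rIn\<close> tells whether the vertex
  lies in a bag around \<open>rX\<close>.\<close>

definition list_prog :: com where
  "list_prog =
     Assign rLen (Const 1) ;;
     For rV rN
      (Assign rIn (Const 0) ;;
       For rY rM
        (Cond (Neg (Conj (Neg (Equal (Var rX) (Var rY))) (Equal (adjE rX rY) (Const 0))))
          (Cond (Less (Const 0) (incE rY rV)) (Assign rIn (Const 1)) Skip) Skip) ;;
       Cond (Equal (Var rIn) (Const 1)) (ball_prog ;; extend_prog) Skip)"

text \<open>Sums over all listed sets at once: an entry copies the value at its pointer and adds the
  contribution of its last vertex, held in \<open>rL\<close>. Cardinalities and table addresses are
  both computed in this way.\<close>

definition accum_prog :: "nat \<Rightarrow> aexp \<Rightarrow> bexp \<Rightarrow> aexp \<Rightarrow> com" where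
  "accum_prog X e0 b e1 =
     Store X (Const 0) e0 ;;
     For rI rLen
      (Cond (Equal (Var rI) (Const 0)) Skip
        (Assign rL (Elem aLast (Var rI)) ;;
         Store X (Var rI) (Elem X (Elem aPar (Var rI))) ;;
         Cond b (Store X (Var rI) (Plus (Elem X (Var rI)) e1)) Skip))"

lemma extend_writes [simp]:
  "wregs extend_prog = {rOld, rI, rLen}" "warrs extend_prog = {aOk, aPar, aLast}"
  by (auto simp: extend_prog_def)

lemma list_writes [simp]:
  "wregs list_prog = {rLen, rV, rIn, rY, rI, rJ, rW, rOld}"
  "warrs list_prog = {aBall, aNext, aOk, aPar, aLast}"
  by (auto simp: list_prog_def)

lemma accum_writes [simp]:
  "wregs (accum_prog X e0 b e1) = {rI, rL}" "warrs (accum_prog X e0 b e1) = {X}"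
  by (auto simp: accum_prog_def)

context decomposition
begin

text \<open>Entry \<open>i > 0\<close> of the list is obtained from entry \<open>aPar i < i\<close> by adding the vertex \<open>aLast i\<close>.\<close>

definition repr :: "state \<Rightarrow> nat set list \<Rightarrow> bool" where
  "repr s Ls \<longleftrightarrow> regs s rLen = length Ls \<and> 0 < length Ls \<and> Ls ! 0 = {} \<and>
     (\<forall>i. 0 < i \<longrightarrow> i < length Ls \<longrightarrow> arrs s aPar i < i \<and> arrs s aLast i < n \<and>
        arrs s aLast i \<notin> Ls ! arrs s aPar i \<and> Ls ! i = insert (arrs s aLast i) (Ls ! arrs s aPar i))"

lemma reprD:
  assumes "repr s Ls"
  shows "regs s rLen = length Ls" "0 < length Ls" "Ls ! 0 = {}"
    "\<And>i. 0 < i \<Longrightarrow> i < length Ls \<Longrightarrow> arrs s aPar i < i"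
    "\<And>i. 0 < i \<Longrightarrow> i < length Ls \<Longrightarrow> arrs s aLast i < n"
    "\<And>i. 0 < i \<Longrightarrow> i < length Ls \<Longrightarrow> arrs s aLast i \<notin> Ls ! arrs s aPar i"
    "\<And>i. 0 < i \<Longrightarrow> i < length Ls \<Longrightarrow> Ls ! i = insert (arrs s aLast i) (Ls ! arrs s aPar i)"
  using assms unfolding repr_def by blast+

lemma repr_frame:
  assumes "repr s Ls" "frame X Y s s'" "rLen \<notin> X" "aPar \<notin> Y" "aLast \<notin> Y"
  shows "repr s' Ls"
proof -
  have "regs s' rLen = regs s rLen" "arrs s' aPar = arrs s aPar" "arrs s' aLast = arrs s aLast"
    using assms by (auto simp: frame_def)
  then show ?thesis using assms(1) unfolding repr_def by simp
qed

lemma repr_finite: "repr s Ls \<Longrightarrow> i < length Ls \<Longrightarrow> finite (Ls ! i)"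
proof (induction i rule: less_induct)
  case (less i)
  show ?case
  proof (cases "i = 0")
    case True
    then show ?thesis using reprD(3)[OF less(2)] by simp
  next
    case False
    then show ?thesis
      using less(1)[of "arrs s aPar i"] reprD(4,7)[OF less(2), of i] less(2,3) by simp
  qed
qed

lemma repr_append:
  assumes "repr s Ls" "v < n" "i < length Ls" "v \<notin> Ls ! i"
    and "regs s' rLen = Suc (length Ls)"
    "arrs s' aPar = (arrs s aPar)(length Ls := i)" "arrs s' aLast = (arrs s aLast)(length Ls := v)"
  shows "repr s' (Ls @ [insert v (Ls ! i)])"
proof -
  have "arrs s' aPar j < j \<and> arrs s' aLast j < n \<and>
      arrs s' aLast j \<notin> (Ls @ [insert v (Ls ! i)]) ! arrs s' aPar j \<and>
      (Ls @ [insert v (Ls ! i)]) ! j =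
        insert (arrs s' aLast j) ((Ls @ [insert v (Ls ! i)]) ! arrs s' aPar j)"
    if "0 < j" "j < Suc (length Ls)" for j
  proof (cases "j = length Ls")
    case True
    then show ?thesis using assms by (simp add: nth_append)
  next
    case False
    then show ?thesis using that assms reprD(4-7)[OF assms(1), of j] by (simp add: nth_append)
  qed
  then show ?thesis using assms reprD(2,3)[OF assms(1)] by (simp add: repr_def nth_append)
qed

lemma runs_extend:
  assumes rp: "repr s Ls" and v: "regs s rV = v" "v < n" "\<And>A. A \<in> set Ls \<Longrightarrow> v \<notin> A"
    and ball: "\<forall>u<n. arrs s aBall u = 0 \<longleftrightarrow> \<not> gdist G u v \<le> enat (2 * \<rho>)"
    and B: "length Ls \<le> B"
  shows "runs B extend_prog s
    (\<lambda>s'. repr s' (Ls @ map (insert v) (filter (\<lambda>A. compat A v) Ls)))"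
proof -
  let ?s = "s\<lparr>regs := (regs s)(rOld := length Ls)\<rparr>"
  \<comment> \<open>The list after the first \<open>j\<close> old entries have been tried. It begins
    with \<open>Ls\<close>, so indices and pointers of old entries stay valid while the list
    grows.\<close>
  let ?L = "\<lambda>j. Ls @ map (insert v) (filter (\<lambda>A. compat A v) (take j Ls))"
  have "runs B (For rI rOld
      (Cond (Equal (Var rI) (Const 0)) (Store aOk (Var rI) (Const 1))
        (Cond (Conj (Less (Const 0) (Elem aOk (Elem aPar (Var rI))))
                    (Equal (Elem aBall (Elem aLast (Var rI))) (Const 0)))
          (Store aOk (Var rI) (Const 1)) (Store aOk (Var rI) (Const 0))) ;;
       Cond (Less (Const 0) (Elem aOk (Var rI)))
        (Store aPar (Var rLen) (Var rI) ;; Store aLast (Var rLen) (Var rV) ;;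
         Assign rLen (Plus (Var rLen) (Const 1))) Skip)) ?s (\<lambda>s'. repr s' (?L (length Ls)))"
  proof (rule runs_For[where I = "\<lambda>j s'. repr s' (?L j) \<and>
      (\<forall>i<j. 0 < arrs s' aOk i \<longleftrightarrow> compat (Ls ! i) v)"], goal_cases)
    case 5
    have "frame {rOld, rI} {} s (?s\<lparr>regs := (regs ?s)(rI := 0)\<rparr>)" by (auto simp: frame_def)
    from repr_frame[OF rp this] show ?case by simp
  next
    case (6 j s1)
    have j: "j < length Ls" using 6(1) by simp
    have fr: "regs s1 rV = v" "arrs s1 aBall = arrs s aBall" "regs s1 rI = j"
      using 6(2,4) v by (auto simp: frame_def)
    have rp1: "repr s1 (?L j)" and ok1: "\<forall>i<j. 0 < arrs s1 aOk i \<longleftrightarrow> compat (Ls ! i) v"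
      using 6(3) by auto
    define c where "c \<longleftrightarrow> compat (Ls ! j) v"
    have c0: "c" if "j = 0" using that reprD(3)[OF rp] by (simp add: c_def compat_def)
    \<comment> \<open>The pointer of entry \<open>j\<close> is smaller than \<open>j\<close>, so the
      flag stored there is already correct for \<open>v\<close>.\<close>
    have c1: "c \<longleftrightarrow> 0 < arrs s1 aOk (arrs s1 aPar j) \<and> arrs s aBall (arrs s1 aLast j) = 0" if "0 < j"
    proof -
      have p: "arrs s1 aPar j < j" "arrs s1 aLast j < n"
        using reprD(4,5)[OF rp1, of j] that j by auto
      moreover have "Ls ! j = insert (arrs s1 aLast j) (Ls ! arrs s1 aPar j)"
        using reprD(7)[OF rp1, of j] that j p(1) by (simp add: nth_append)
      ultimately show ?thesis using ok1 ball by (auto simp: c_def compat_def)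
    qed
    have v_notin: "v \<notin> Ls ! j" using v(3) j by simp
    have Lj: "?L (Suc j) = (if c then ?L j @ [insert v (?L j ! j)] else ?L j)"
      using j by (simp add: take_Suc_conv_app_nth c_def nth_append)
    have step: "repr s2 (?L (Suc j)) \<and> (\<forall>i<Suc j. 0 < arrs s2 aOk i \<longleftrightarrow> compat (Ls ! i) v)"
      if "frame {rI, rLen} {aOk, aPar, aLast} s1 s2"
        "\<forall>i<j. arrs s2 aOk i = arrs s1 aOk i" "0 < arrs s2 aOk j \<longleftrightarrow> c"
        "regs s2 rLen = (if c then Suc (regs s1 rLen) else regs s1 rLen)"
        "arrs s2 aPar = (if c then (arrs s1 aPar)(regs s1 rLen := j) else arrs s1 aPar)"
        "arrs s2 aLast = (if c then (arrs s1 aLast)(regs s1 rLen := v) else arrs s1 aLast)" for s2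
    proof
      have len: "regs s1 rLen = length (?L j)" using reprD(1)[OF rp1] .
      show "repr s2 (?L (Suc j))"
      proof (cases c)
        case True
        show ?thesis unfolding Lj using True
          apply simp
          apply (rule repr_append[OF rp1 v(2), of j s2, simplified])
          using j v_notin that len True by (auto simp: nth_append)
      next
        case False
        then have "frame {rI} {aOk} s1 s2" using that by (auto simp: frame_def)
        then show ?thesis unfolding Lj using False repr_frame[OF rp1] by auto
      qed
      show "\<forall>i<Suc j. 0 < arrs s2 aOk i \<longleftrightarrow> compat (Ls ! i) v"
        using that ok1 by (auto simp: less_Suc_eq c_def)
    qed
    show ?case
      apply (intro runs_intros)
        apply (rule step; use fr c0 c1 in \<open>auto simp: frame_def\<close>)+
      done
  qed (use rp B in \<open>auto\<close>)
  then show ?thesis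
    unfolding extend_prog_def using reprD(1)[OF rp] by (intro runs_Seq runs_Assign) simp
qed

lemma runs_list:
  assumes st: "static s" and x: "regs s rX = x" "x < m"
    and B: "n * n \<le> B" "card {A. A \<subseteq> bags (nbh x) \<and> indep A} \<le> B"
  shows "runs B list_prog s (\<lambda>s'. repr s' (indep_list (bags (nbh x)) n))"
proof -
  let ?X = "bags (nbh x)"
  have B': "n \<le> B" "m \<le> B" using B(1) nodes by (meson le_square order_trans)+
  let ?s = "s\<lparr>regs := (regs s)(rLen := 1)\<rparr>"
  show ?thesis
    unfolding list_prog_def
  proof (intro runs_Seq[of B "Assign rLen _"] runs_Assign
      runs_For[where I = "\<lambda>v s'. repr s' (indep_list ?X v)"], goal_cases)
    case 5
    show ?case by (simp add: repr_def)
  next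
    case (6 v s1)
    have fr1: "frame {rLen, rV, rIn, rY, rI, rJ, rW, rOld} {aBall, aNext, aOk, aPar, aLast} s s1"
      using 6(4) by (auto simp: frame_def)
    have st1: "static s1" using static_frame[OF st fr1] by simp
    have v: "v < n" using 6(1) st by (simp add: staticD)
    have x1: "regs s1 rX = x" using fr1 x by (simp add: frame_def)
    let ?s1 = "s1\<lparr>regs := (regs s1)(rIn := 0)\<rparr>"
    have loop: "runs B (For rY rM
        (Cond (Neg (Conj (Neg (Equal (Var rX) (Var rY))) (Equal (adjE rX rY) (Const 0))))
          (Cond (Less (Const 0) (incE rY rV)) (Assign rIn (Const 1)) Skip) Skip)) ?s1
       (\<lambda>s'. regs s' rIn = of_bool (v \<in> ?X))"
    proof (rule runs_For[where I = "\<lambda>j s'. regs s' rIn = of_bool (\<exists>y<j. y \<in> nbh x \<and> v \<in> bag y)"], goal_cases)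
      case (6 j s2)
      have fr2: "frame {rIn, rY} {} s1 s2" using 6(4) by (auto simp: frame_def)
      have st2: "static s2" using static_frame[OF st1 fr2] by simp
      have j: "j < m" using 6(1) st1 by (simp add: staticD)
      have "regs s2 rX = x" "regs s2 rV = v" "regs s2 rY = j"
        using fr2 x1 6(2) \<open>regs s1 rV = v\<close> by (auto simp: frame_def)
      then show ?case
        using 6(3) staticD(5)[OF st2 x(2) j] staticD(6)[OF st2, of j v] j v
        by (intro runs_intros) (auto simp: less_Suc_eq nbh_def)
    next
      case (7 s2)
      have "(\<exists>y<m. y \<in> nbh x \<and> v \<in> bag y) \<longleftrightarrow> v \<in> ?X" using x(2) by (auto simp: nbh_def dest: adj_less)
      then show ?case using 7(1) st1 by (simp add: staticD)
    qed (use st1 B' in \<open>auto simp: staticD\<close>)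
    show ?case
    proof (rule runs_Seq, rule runs_Assign, unfold aval.simps, rule runs_Seq'[OF loop],
        rule runs_Cond, goal_cases)
      case (1 s2)
      have fr2: "frame {rIn, rY} {} s1 s2" using 1(2) by (auto simp: frame_def)
      have st2: "static s2" using static_frame[OF st1 fr2] by simp
      have vX: "v \<in> ?X"
      proof -
        have "of_bool (v \<in> ?X) = (1 :: nat)" using 1(1,3) by (simp only: bval.simps aval.simps)
        then show ?thesis by (simp only: of_bool_eq_1_iff)
      qed
      have v2: "regs s2 rV = v" using fr2 6(2) by (simp add: frame_def)
      have rp2: "repr s2 (indep_list ?X v)" using repr_frame[OF 6(3) fr2] by simp
      show ?case
      proof (rule runs_Seq'[OF runs_ball[OF st2 v2 v B(1)]])
        fix s3
        assume 3: "\<forall>u<n. (arrs s3 aBall u = 0) = (\<not> gdist G u v \<le> enat (2 * \<rho>))"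
          "frame (wregs ball_prog) (warrs ball_prog) s2 s3"
        have rp3: "repr s3 (indep_list ?X v)" using repr_frame[OF rp2 3(2)] by simp
        have v3: "regs s3 rV = v" using v2 3(2) by (simp add: frame_def)
        have "v \<notin> A" if "A \<in> set (indep_list ?X v)" for A
          using that v set_indep_list[of v ?X] by auto
        moreover have "length (indep_list ?X v) \<le> B"
          using length_indep_list[of v ?X] v B(2) by simp
        ultimately have "runs B extend_prog s3 (\<lambda>s'. repr s' (indep_list ?X (Suc v)))"
          using runs_extend[OF rp3 v3 v _ 3(1)] vX by simp
        then show "runs B extend_prog s3 (\<lambda>s''. repr (s''\<lparr>regs := (regs s'')(rV := Suc v)\<rparr>) (indep_list ?X (Suc v)))"
          by (rule runs_mono) (simp add: repr_def)
      qed
    next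
      case (2 s2)
      have fr2: "frame {rIn, rY} {} s1 s2" using 2(2) by (auto simp: frame_def)
      have "of_bool (v \<in> ?X) \<noteq> (1 :: nat)" using 2(1,3) by (simp only: bval.simps aval.simps not_False_eq_True)
      then have "v \<notin> ?X" by (simp only: of_bool_eq_1_iff not_False_eq_True)
      then have "indep_list ?X (Suc v) = indep_list ?X v" by simp
      moreover have "repr s2 (indep_list ?X v)" using repr_frame[OF 6(3) fr2] by simp
      ultimately show ?case by (intro runs_Skip) (simp add: repr_def)
    qed
  qed (use st B' in \<open>auto simp: staticD\<close>)
qed

text \<open>\<open>w v\<close> is what the test \<open>b\<close> and the expression
  \<open>e1\<close> contribute for the vertex \<open>v\<close>. The sum grows by exactly this amount
  because the last vertex of an entry is not in the set at its pointer.\<close>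

lemma runs_accum:
  assumes rp: "repr s Ls" and B: "length Ls \<le> B" and X: "X \<noteq> aPar" "X \<noteq> aLast"
    and w: "\<And>s' v. \<lbrakk>v < n; regs s' rL = v; frame {rI, rL} {X} s s'\<rbrakk>
       \<Longrightarrow> (if bval b s' then aval e1 s' else 0) = w v"
  shows "runs B (accum_prog X e0 b e1) s (\<lambda>s'. \<forall>i<length Ls. arrs s' X i = aval e0 s + sum w (Ls ! i))"
proof -
  let ?s = "s\<lparr>arrs := (arrs s)(X := (arrs s X)(0 := aval e0 s))\<rparr>"
  have "runs B (For rI rLen
      (Cond (Equal (Var rI) (Const 0)) Skip
        (Assign rL (Elem aLast (Var rI)) ;;
         Store X (Var rI) (Elem X (Elem aPar (Var rI))) ;;
         Cond b (Store X (Var rI) (Plus (Elem X (Var rI)) e1)) Skip))) ?s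
     (\<lambda>s'. \<forall>i<length Ls. arrs s' X i = aval e0 s + sum w (Ls ! i))"
  proof (rule runs_For[where I = "\<lambda>j s'. arrs s' X 0 = aval e0 s \<and>
      (\<forall>i<j. arrs s' X i = aval e0 s + sum w (Ls ! i))"], goal_cases)
    case (6 j s1)
    have fr1: "frame {rI, rL} {X} s s1" using 6(4) by (auto simp: frame_def)
    have rp1: "repr s1 Ls" using repr_frame[OF rp fr1] X by simp
    have j: "j < length Ls" using 6(1) reprD(1)[OF rp] by simp
    show ?case
    proof (rule runs_Cond)
      assume "bval (Equal (Var rI) (Const 0)) s1"
      then have "j = 0" using 6(2) by simp
      then show "runs B Skip s1 (\<lambda>s''. arrs (s''\<lparr>regs := (regs s'')(rI := Suc j)\<rparr>) X 0 = aval e0 s \<and>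
          (\<forall>i<Suc j. arrs (s''\<lparr>regs := (regs s'')(rI := Suc j)\<rparr>) X i = aval e0 s + sum w (Ls ! i)))"
        using 6(3) reprD(3)[OF rp] by (intro runs_Skip) simp
    next
      assume "\<not> bval (Equal (Var rI) (Const 0)) s1"
      then have j0: "0 < j" using 6(2) by simp
      let ?v = "arrs s1 aLast j" and ?p = "arrs s1 aPar j"
      note r = reprD(4-7)[OF rp1 j0 j]
      have "finite (Ls ! ?p)" using repr_finite[OF rp1] r(1) j by simp
      then have sum: "sum w (Ls ! j) = w ?v + sum w (Ls ! ?p)"
        using r(3) by (subst r(4)) simp
      let ?s2 = "s1\<lparr>regs := (regs s1)(rL := ?v),
          arrs := (arrs s1)(X := (arrs s1 X)(j := arrs s1 X ?p))\<rparr>"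
      have "frame {rI, rL} {X} s ?s2" using fr1 by (auto simp: frame_def)
      then have wv: "(if bval b ?s2 then aval e1 ?s2 else 0) = w ?v"
        using w[of ?v ?s2] r(2) by simp
      have p: "arrs s1 X ?p = aval e0 s + sum w (Ls ! ?p)" using 6(3) r(1) by blast
      show "runs B (Assign rL (Elem aLast (Var rI)) ;;
         Store X (Var rI) (Elem X (Elem aPar (Var rI))) ;;
         Cond b (Store X (Var rI) (Plus (Elem X (Var rI)) e1)) Skip) s1
         (\<lambda>s''. arrs (s''\<lparr>regs := (regs s'')(rI := Suc j)\<rparr>) X 0 = aval e0 s \<and>
          (\<forall>i<Suc j. arrs (s''\<lparr>regs := (regs s'')(rI := Suc j)\<rparr>) X i = aval e0 s + sum w (Ls ! i)))"
        apply (rule runs_Seq, rule runs_Assign, rule runs_Seq, rule runs_Store)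
        apply (rule runs_Cond; rule runs_Store runs_Skip)
        using wv X 6(2,3) j0 sum p by (auto simp: less_Suc_eq)
    qed
  next
    case 5 then show ?case by simp
  next
    case (7 s1)
    then show ?case using reprD(1)[OF rp] by simp
  qed (use rp B in \<open>auto simp: reprD(1)\<close>)
  then show ?thesis unfolding accum_prog_def by (intro runs_Seq runs_Store) simp
qed

end

section \<open>Peeling one leaf\<close>

text \<open>\<open>rQ = m\<close> means that no unpeeled neighbour has been seen yet; a second one
  sets \<open>rBad\<close>. Later successes overwrite earlier ones, as any leaf will do.\<close>

definition find_prog :: com where
  "find_prog =
     For rY rM
      (Cond (Equal (Elem aRem (Var rY)) (Const 0))
        (Assign rQ (Var rM) ;; Assign rBad (Const 0) ;;
         For rZ rM
          (Cond (Conj (Less (Const 0) (adjE rY rZ)) (Equal (Elem aRem (Var rZ)) (Const 0)))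
            (Cond (Equal (Var rQ) (Var rM)) (Assign rQ (Var rZ)) (Assign rBad (Const 1))) Skip) ;;
         Cond (Equal (Var rBad) (Const 0)) (Assign rX (Var rY) ;; Assign rP (Var rQ)) Skip)
        Skip)"

lemma find_writes [simp]:
  "wregs find_prog = {rY, rQ, rBad, rZ, rX, rP}" "warrs find_prog = {}"
  by (auto simp: find_prog_def)

context decomposition
begin

definition removed where "removed s = {x. x < m \<and> arrs s aRem x \<noteq> 0}"

text \<open>The loop invariant is conditional on a leaf having been scanned;
  \<open>forest_leaf\<close>, applied to the unpeeled nodes, supplies one in the end. Intersecting
  with \<open>{..<m}\<close> treats a unique neighbour and the absence of one
  (\<open>rP = m\<close>) alike.\<close>

lemma runs_find:
  assumes st: "static s" and B: "m \<le> B" and R: "removed s \<noteq> {..<m}"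
  shows "runs B find_prog s (\<lambda>s'. regs s' rX < m \<and> regs s' rX \<notin> removed s \<and> regs s' rP \<le> m \<and>
     {y. adj (regs s' rX) y \<and> y \<notin> removed s} = {regs s' rP} \<inter> {..<m})"
proof -
  let ?N = "\<lambda>x. {y. adj x y \<and> y \<notin> removed s}"
  let ?good = "\<lambda>s'. regs s' rX < m \<and> regs s' rX \<notin> removed s \<and> regs s' rP \<le> m \<and>
     ?N (regs s' rX) = {regs s' rP} \<inter> {..<m}"
  show ?thesis
    unfolding find_prog_def
  proof (rule runs_For[where I = "\<lambda>j s'. (\<exists>x<j. x \<notin> removed s \<and> (\<exists>p. ?N x \<subseteq> {p})) \<longrightarrow> ?good s'"], goal_cases)
    case (6 j s1)
    have fr1: "frame {rY, rQ, rBad, rZ, rX, rP} {} s s1" using 6(4) by (auto simp: frame_def)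
    have st1: "static s1" using static_frame[OF st fr1] by simp
    have j: "j < m" using 6(1) st by (simp add: staticD)
    have rem: "arrs s1 aRem = arrs s aRem" using fr1 by (simp add: frame_def)
    show ?case
    proof (rule runs_Cond, goal_cases)
      case 2
      then have "j \<in> removed s" using 6(2) j rem by (simp add: removed_def)
      then show ?case using 6(3) by (intro runs_Skip) (auto simp: less_Suc_eq)
    next
      case 1
      then have jR: "j \<notin> removed s" using 6(2) rem by (simp add: removed_def)
      let ?s0 = "s1\<lparr>regs := (regs s1)(rQ := aval (Var rM) s1)\<rparr>"
      let ?s1 = "?s0\<lparr>regs := (regs ?s0)(rBad := aval (Const 0) ?s0)\<rparr>"
      let ?M = "\<lambda>l. ?N j \<inter> {..<l}"
      have loop: "runs B (For rZ rM
          (Cond (Conj (Less (Const 0) (adjE rY rZ)) (Equal (Elem aRem (Var rZ)) (Const 0)))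
            (Cond (Equal (Var rQ) (Var rM)) (Assign rQ (Var rZ)) (Assign rBad (Const 1))) Skip)) ?s1
          (\<lambda>s'. if regs s' rBad = 0 then regs s' rQ \<le> m \<and> ?N j = {regs s' rQ} \<inter> {..<m}
             else \<not> (\<exists>p. ?N j \<subseteq> {p}))"
      proof (rule runs_For[where I = "\<lambda>l s'. if regs s' rBad = 0
          then regs s' rQ \<le> m \<and> ?M l = {regs s' rQ} \<inter> {..<m} else \<not> (\<exists>p. ?N j \<subseteq> {p})"], goal_cases)
        case (6 l s2)
        have fr2: "frame {rQ, rBad, rZ} {} s1 s2" using 6(4) by (auto simp: frame_def)
        have st2: "static s2" using static_frame[OF st1 fr2] by simp
        have l: "l < m" using 6(1) st1 by (simp add: staticD)
        have r: "regs s2 rY = j" "regs s2 rZ = l" "arrs s2 aRem = arrs s aRem" "regs s2 rM = m"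
          using fr2 6(2) \<open>regs s1 rY = j\<close> rem staticD(2)[OF st2] by (auto simp: frame_def)
        have c: "bval (Conj (Less (Const 0) (adjE rY rZ)) (Equal (Elem aRem (Var rZ)) (Const 0))) s2
            \<longleftrightarrow> l \<in> ?N j"
          using staticD(5)[OF st2 j l] r l by (auto simp: removed_def)
        have M: "?M (Suc l) = (if l \<in> ?N j then insert l (?M l) else ?M l)"
          by (auto simp: less_Suc_eq)
        show ?case
        proof (rule runs_Cond, goal_cases)
          case 1
          then have lN: "l \<in> ?N j" using c by blast
          have two: "\<not> (\<exists>p. ?N j \<subseteq> {p})" if "regs s2 rBad = 0" "regs s2 rQ \<noteq> m"
          proof -
            have "regs s2 rQ \<in> ?M l" using 6(3) that by auto
            then have "regs s2 rQ \<in> ?N j" "regs s2 rQ \<noteq> l" by auto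
            then show ?thesis using lN by auto
          qed
          have one: "?M (Suc l) = {l} \<inter> {..<m}" if "regs s2 rBad = 0" "regs s2 rQ = m"
          proof -
            have "?M l = {}" using 6(3) that by auto
            then show ?thesis unfolding M using lN l by simp
          qed
          have bad: "\<not> (\<exists>p. ?N j \<subseteq> {p})" if "regs s2 rQ \<noteq> m \<or> regs s2 rBad \<noteq> 0"
          proof (cases "regs s2 rBad = 0")
            case True then show ?thesis using two that by blast
          next
            case False then show ?thesis using 6(3) by (simp only: if_False not_False_eq_True)
          qed
          show ?case
          proof ((rule runs_Cond; rule runs_Assign), goal_cases)
            case 1
            then have "regs s2 rQ = m" using r by simp
            then show ?case
              using bad one l r(2) by (cases "regs s2 rBad = 0") simp_all
          next
            case 2
            then show ?case using bad r by simp
          qed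
        next
          case 2
          then have "l \<notin> ?N j" using c by blast
          then have "?M (Suc l) = ?M l" unfolding M by (simp only: if_False)
          then show ?case
            using 6(3) by (intro runs_Skip) simp
        qed
      next
        case (7 s2)
        have "regs ?s1 rM = m" using staticD(2)[OF st1] by simp
        moreover have "?M m = ?N j" by (auto dest: adj_less)
        ultimately show ?case using 7(1) by (simp only:)
      qed (use st1 B in \<open>auto simp: staticD\<close>)
      show ?case
      proof (rule runs_Seq, rule runs_Assign, rule runs_Seq, rule runs_Assign,
          rule runs_Seq'[OF loop], goal_cases)
        case (1 s2)
        have 2: "if regs s2 rBad = 0 then regs s2 rQ \<le> m \<and> ?N j = {regs s2 rQ} \<inter> {..<m}
             else \<not> (\<exists>p. ?N j \<subseteq> {p})"
          using 1(1) .
        have fr2: "frame {rQ, rBad, rZ} {} s1 s2" using 1(2) by (auto simp: frame_def)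
        have r: "regs s2 rY = j" "regs s2 rX = regs s1 rX" "regs s2 rP = regs s1 rP"
          using fr2 6(2) by (auto simp: frame_def)
        show ?case
          apply (rule runs_Cond)
           apply (rule runs_Seq, rule runs_Assign, rule runs_Assign)
          subgoal using 2 j jR r by simp
          subgoal using 2 6(3) r by (intro runs_Skip) (auto simp: less_Suc_eq)
          done
      qed
    qed
  next
    case (7 s1)
    have "removed s \<subseteq> {..<m}" by (auto simp: removed_def)
    then have "{..<m} - removed s \<noteq> {}" using R by blast
    then obtain x p where "x \<in> {..<m} - removed s"
      "{y \<in> {..<m} - removed s. (x, y) \<in> edges T} \<subseteq> {p}"
      using forest_leaf[OF T, of "{..<m} - removed s"] vT by blast
    moreover have "{y \<in> {..<m} - removed s. (x, y) \<in> edges T} = ?N x"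
      using adj_less by (auto simp: adj_def)
    ultimately have "\<exists>x<m. x \<notin> removed s \<and> (\<exists>p. ?N x \<subseteq> {p})" by auto
    then show ?case using 7(1) st by (simp add: staticD)
  qed (use st B in \<open>auto simp: staticD\<close>)
qed

end

text \<open>The address is a binary number: bit \<open>n + z\<close> marks the node, the bits below
  \<open>n\<close> are the trace on two bags. The sum of two incidence entries being positive
  expresses the union of the bags.\<close>

definition key_prog :: "nat \<Rightarrow> nat \<Rightarrow> nat \<Rightarrow> com" where
  "key_prog z a b = accum_prog aKey (Elem aPow (Plus (Var rN) (Var z)))
     (Less (Const 0) (Plus (incE a rL) (incE b rL))) (Elem aPow (Var rL))"

text \<open>The neighbours of \<open>rX\<close> other than \<open>rP\<close> are its peeled
  children. A child's entry already counts the child's own bag, so only the bag of \<open>rX\<close>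
  is counted directly.\<close>

definition value_prog :: com where
  "value_prog =
     accum_prog aVal (Const 0) (Less (Const 0) (incE rX rL)) (Const 1) ;;
     For rY rM
      (Cond (Conj (Less (Const 0) (adjE rX rY)) (Neg (Equal (Var rY) (Var rP))))
        (key_prog rY rX rY ;;
         For rI rLen (Store aVal (Var rI) (Plus (Elem aVal (Var rI)) (Elem aF (Elem aKey (Var rI))))))
        Skip)"

text \<open>Without a parent \<open>rA\<close> and \<open>rP\<close> both equal \<open>m\<close>,
  whose bag is empty, so all sets share the key of the empty trace and compete for a single entry.
  Entries start at 0, which is below every value, so the maximum needs no initialisation.\<close>

definition table_prog :: com where
  "table_prog =
     Assign rA (Var rX) ;;
     Cond (Equal (Var rP) (Var rM)) (Assign rA (Var rM)) Skip ;;
     key_prog rX rA rP ;;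
     For rI rLen
      (Cond (Less (Elem aF (Elem aKey (Var rI))) (Elem aVal (Var rI)))
        (Store aF (Elem aKey (Var rI)) (Elem aVal (Var rI))) Skip)"

text \<open>If \<open>rX\<close> has no parent, the entry for the empty trace, at address
  \<open>2 ^ (n + x)\<close>, is the final gain of its component and goes into register 0.\<close>

definition step_prog :: com where
  "step_prog = find_prog ;; list_prog ;; value_prog ;; table_prog ;;
     Cond (Equal (Var rP) (Var rM))
       (Assign 0 (Plus (Var 0) (Elem aF (Elem aPow (Plus (Var rN) (Var rX)))))) Skip ;;
     Store aRem (Var rX) (Const 1)"

definition alpha_prog :: com where
  "alpha_prog = setup_prog ;; For rIt rM step_prog"

lemma key_writes [simp]: "wregs (key_prog z a b) = {rI, rL}" "warrs (key_prog z a b) = {aKey}"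
  by (simp_all add: key_prog_def)

lemma value_writes [simp]: "wregs value_prog = {rI, rL, rY}" "warrs value_prog = {aVal, aKey}"
  by (auto simp: value_prog_def)

lemma table_writes [simp]: "wregs table_prog = {rA, rI, rL}" "warrs table_prog = {aKey, aF}"
  by (auto simp: table_prog_def)

context decomposition
begin

text \<open>The summand \<open>2 ^ (n + x)\<close> keeps the table entries of different nodes apart.\<close>

definition key :: "nat \<Rightarrow> nat set \<Rightarrow> nat" where
  "key x S = 2 ^ (n + x) + set_encode S"

text \<open>\<open>key x S\<close> is the binary code of \<open>insert (n + x) S\<close>. The bit
  \<open>n + x\<close> lies above all vertices, so the code determines both the node and the
  trace.\<close>

lemma key_inject:
  assumes "key x S = key y S'" "S \<subseteq> {..<n}" "S' \<subseteq> {..<n}"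
  shows "x = y \<and> S = S'"
proof -
  have fin: "finite S" "finite S'" using assms finite_subset by blast+
  have notin: "n + x \<notin> S" "n + y \<notin> S'" using assms by auto
  have "set_encode (insert (n + x) S) = set_encode (insert (n + y) S')"
    using assms(1) fin notin by (simp add: key_def)
  then have eq: "insert (n + x) S = insert (n + y) S'" using fin by (subst (asm) set_encode_eq) auto
  moreover from eq have "x = y" using assms(2,3) by auto
  ultimately show ?thesis using notin by (metis insert_ident)
qed

text \<open>Cells at meaningless arguments are masked by 0. This lets the effect of one peeling be
  the equation \<open>table s4 = (table s)(x := g)\<close> between functions.\<close>

definition table :: "state \<Rightarrow> nat \<Rightarrow> nat set \<Rightarrow> nat" where
  "table s x S = (if x < m \<and> S \<subseteq> {..<n} then arrs s aF (key x S) else 0)"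

lemma bag_subset: "bag x \<subseteq> {..<n}"
  using bag_less by auto

lemma runs_key:
  assumes st: "static s" and rp: "repr s Ls" and B: "length Ls \<le> B"
    and z: "regs s z = x" "x \<le> m" and a: "regs s a = a'" "a' \<le> m" "a \<notin> {rI, rL}"
    and b: "regs s b = b'" "b' \<le> m" "b \<notin> {rI, rL}"
  shows "runs B (key_prog z a b) s
    (\<lambda>s'. \<forall>i<length Ls. arrs s' aKey i = key x (Ls ! i \<inter> (bag a' \<union> bag b')))"
  unfolding key_prog_def
proof (rule runs_mono[OF runs_accum[OF rp B, where w = "\<lambda>v. if v \<in> bag a' \<union> bag b' then 2 ^ v else 0"]],
    goal_cases)
  case (3 s1 v)
  have st1: "static s1" using static_frame[OF st 3(3)] by simp
  have "regs s1 a = a'" "regs s1 b = b'" using 3(3) a b by (auto simp: frame_def)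
  then show ?case
    using staticD(6)[OF st1 a(2) 3(1)] staticD(6)[OF st1 b(2) 3(1)] staticD(7)[OF st1, of v] 3(1,2)
    by simp
next
  case (4 s1)
  show ?case
  proof (intro allI impI)
    fix i assume i: "i < length Ls"
    have "(\<Sum>v\<in>Ls ! i. if v \<in> bag a' \<union> bag b' then 2 ^ v else 0) =
        set_encode (Ls ! i \<inter> (bag a' \<union> bag b'))"
      unfolding set_encode_def by (rule sum.inter_restrict[OF repr_finite[OF rp i], symmetric])
    then show "arrs s1 aKey i = key x (Ls ! i \<inter> (bag a' \<union> bag b'))"
      using 4(1) i z staticD(7)[OF st, of "n + x"] staticD(1)[OF st] by (simp add: key_def)
  qed
qed auto

lemma runs_value:
  assumes st: "static s" and rp: "repr s Ls" and B: "length Ls \<le> B" "m \<le> B"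
    and x: "regs s rX = x" "x < m" and p: "regs s rP = p"
  shows "runs B value_prog s (\<lambda>s'. \<forall>i<length Ls. arrs s' aVal i = card (Ls ! i \<inter> bag x) +
     (\<Sum>y | adj x y \<and> y \<noteq> p. table s y (Ls ! i \<inter> (bag x \<union> bag y))))"
  unfolding value_prog_def
proof (rule runs_Seq'[OF runs_accum[OF rp B(1), where w = "\<lambda>v. if v \<in> bag x then 1 else 0"]], goal_cases)
  case (3 s1 v)
  have st1: "static s1" using static_frame[OF st 3(3)] by simp
  have "regs s1 rX = x" using 3(3) x by (auto simp: frame_def)
  then show ?case using staticD(6)[OF st1 _ 3(1), of x] 3(2) x(2) by simp
next
  case (4 s1)
  have st1: "static s1" using static_frame[OF st 4(2)] by simp
  let ?sum = "\<lambda>j i. \<Sum>y | y < j \<and> adj x y \<and> y \<noteq> p. table s y (Ls ! i \<inter> (bag x \<union> bag y))"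
  show ?case
  proof (rule runs_For[where I = "\<lambda>j s'. \<forall>i<length Ls.
      arrs s' aVal i = card (Ls ! i \<inter> bag x) + ?sum j i"], goal_cases)
    case 5
    have "(\<Sum>v\<in>Ls ! i. if v \<in> bag x then 1 else 0) = card (Ls ! i \<inter> bag x)" if "i < length Ls" for i
      using sum.inter_restrict[OF repr_finite[OF rp that], of "\<lambda>_. 1::nat" "bag x"] by simp
    then show ?case using 4(1) by simp
  next
    case (6 j s2)
    have fr2: "frame {rI, rL, rY} {aVal, aKey} s s2" using 4(2) 6(4) by (auto simp: frame_def)
    have st2: "static s2" using static_frame[OF st fr2] by simp
    have rp2: "repr s2 Ls" using repr_frame[OF rp fr2] by simp
    have j: "j < m" using 6(1) st1 by (simp add: staticD)
    have r: "regs s2 rX = x" "regs s2 rP = p" "regs s2 rY = j" "arrs s2 aF = arrs s aF"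
      using fr2 x p 6(2) by (auto simp: frame_def)
    let ?c = "adj x j \<and> j \<noteq> p"
    have c: "bval (Conj (Less (Const 0) (adjE rX rY)) (Neg (Equal (Var rY) (Var rP)))) s2 \<longleftrightarrow> ?c"
      using staticD(5)[OF st2 x(2) j] r by simp
    have sum: "?sum (Suc j) i = (if ?c then table s j (Ls ! i \<inter> (bag x \<union> bag j)) else 0) + ?sum j i" for i
    proof -
      have "{y. y < Suc j \<and> adj x y \<and> y \<noteq> p} =
          (if ?c then insert j {y. y < j \<and> adj x y \<and> y \<noteq> p} else {y. y < j \<and> adj x y \<and> y \<noteq> p})"
        by (auto simp: less_Suc_eq)
      then show ?thesis by simp
    qed
    show ?case
    proof (rule runs_Cond, goal_cases)
      case 1
      then have c': ?c using c by blast
      show ?case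
      proof (rule runs_Seq'[OF runs_key[OF st2 rp2 B(1) r(3) less_imp_le[OF j] r(1) less_imp_le[OF x(2)] _
              r(3) less_imp_le[OF j]]], goal_cases)
        case (3 s3)
        have st3: "static s3" using static_frame[OF st2 3(2)] by simp
        have rp3: "repr s3 Ls" using repr_frame[OF rp2 3(2)] by simp
        have f3: "arrs s3 aVal = arrs s2 aVal" "arrs s3 aF = arrs s aF"
          using 3(2) r by (auto simp: frame_def)
        have tab: "table s j (Ls ! i \<inter> (bag x \<union> bag j)) = arrs s aF (arrs s3 aKey i)" if "i < length Ls" for i
          using that 3(1) j bag_subset by (auto simp: table_def)
        define f g where "f i = ?sum j i" and "g i = ?sum (Suc j) i" for i
        have g: "g i = f i + arrs s aF (arrs s3 aKey i)" if "i < length Ls" for i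
          unfolding f_def g_def sum tab[OF that] using c' by simp
        show ?case
          unfolding g_def[symmetric]
        proof (rule runs_For[where I = "\<lambda>l s'. \<forall>i<length Ls. arrs s' aVal i = card (Ls ! i \<inter> bag x) +
            (if i < l then g i else f i)"], goal_cases)
          case 5
          then show ?case using 6(3) f3 by (simp add: f_def)
        next
          case (6 l s4)
          have "arrs s4 aKey = arrs s3 aKey" "arrs s4 aF = arrs s aF"
            using 6(4) f3 by (auto simp: frame_def)
          moreover have "l < length Ls" using 6(1) reprD(1)[OF rp3] by simp
          ultimately show ?case
            using 6(2,3) g[of l] by (intro runs_Store) (auto simp: less_Suc_eq)
        next
          case (7 s4)
          then show ?case using reprD(1)[OF rp3] by simp
        qed (use reprD(1)[OF rp3] B in auto)
      qed auto
    next
      case 2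
      then have "\<not> ?c" using c by blast
      then have "?sum (Suc j) i = ?sum j i" for i unfolding sum by auto
      then show ?case using 6(3) by (intro runs_Skip) simp
    qed
  next
    case (7 s2)
    have "{y. y < m \<and> adj x y \<and> y \<noteq> p} = {y. adj x y \<and> y \<noteq> p}" by (auto dest: adj_less)
    then show ?case using 7(1) st1 by (simp add: staticD)
  qed (use st1 B in \<open>auto simp: staticD\<close>)
qed auto

text \<open>The two halves characterise a running maximum per address: each cell is initial or
  attained by an entry seen so far, and it dominates all entries with its address.\<close>

lemma running_max_step:
  fixes F F0 V :: "nat \<Rightarrow> nat"
  assumes "\<forall>\<kappa>. (F \<kappa> = F0 \<kappa> \<or> (\<exists>i<j. k i = \<kappa> \<and> F \<kappa> = V i)) \<and> (\<forall>i<j. k i = \<kappa> \<longrightarrow> V i \<le> F \<kappa>)"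
  defines "F' \<equiv> F(k j := max (F (k j)) (V j))"
  shows "\<forall>\<kappa>. (F' \<kappa> = F0 \<kappa> \<or> (\<exists>i<Suc j. k i = \<kappa> \<and> F' \<kappa> = V i)) \<and>
    (\<forall>i<Suc j. k i = \<kappa> \<longrightarrow> V i \<le> F' \<kappa>)"
proof
  fix \<kappa>
  show "(F' \<kappa> = F0 \<kappa> \<or> (\<exists>i<Suc j. k i = \<kappa> \<and> F' \<kappa> = V i)) \<and> (\<forall>i<Suc j. k i = \<kappa> \<longrightarrow> V i \<le> F' \<kappa>)"
    using spec[OF assms(1), of \<kappa>]
    by (cases "\<kappa> = k j") (auto simp: F'_def less_Suc_eq max_def le_less_trans)
qed

lemma runs_table_prog:
  assumes st: "static s" and rp: "repr s Ls" and B: "length Ls \<le> B"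
    and x: "regs s rX = x" "x < m" and p: "regs s rP = p" "p \<le> m"
    and K: "K = (if p < m then bag x \<union> bag p else {})"
  shows "runs B table_prog s (\<lambda>s'. \<forall>\<kappa>.
     (arrs s' aF \<kappa> = arrs s aF \<kappa> \<or>
       (\<exists>i<length Ls. key x (Ls ! i \<inter> K) = \<kappa> \<and> arrs s' aF \<kappa> = arrs s aVal i)) \<and>
     (\<forall>i<length Ls. key x (Ls ! i \<inter> K) = \<kappa> \<longrightarrow> arrs s aVal i \<le> arrs s' aF \<kappa>))"
proof -
  let ?a = "if p = m then m else x"
  have K': "K = bag ?a \<union> bag p" using K p by (auto simp: bag_def)
  have main: "runs B (key_prog rX rA rP ;;
     For rI rLen
      (Cond (Less (Elem aF (Elem aKey (Var rI))) (Elem aVal (Var rI)))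
        (Store aF (Elem aKey (Var rI)) (Elem aVal (Var rI))) Skip)) s1 (\<lambda>s'. \<forall>\<kappa>.
     (arrs s' aF \<kappa> = arrs s aF \<kappa> \<or>
       (\<exists>i<length Ls. key x (Ls ! i \<inter> K) = \<kappa> \<and> arrs s' aF \<kappa> = arrs s aVal i)) \<and>
     (\<forall>i<length Ls. key x (Ls ! i \<inter> K) = \<kappa> \<longrightarrow> arrs s aVal i \<le> arrs s' aF \<kappa>))"
    if fr1: "frame {rA} {} s s1" and a: "regs s1 rA = ?a" for s1
  proof -
    have st1: "static s1" using static_frame[OF st fr1] by simp
    have rp1: "repr s1 Ls" using repr_frame[OF rp fr1] by simp
    have r: "regs s1 rX = x" "regs s1 rP = p" "arrs s1 = arrs s"
      using fr1 x p by (auto simp: frame_def)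
    have am: "?a \<le> m" using x by simp
    show ?thesis
    proof (rule runs_Seq'[OF runs_key[OF st1 rp1 B r(1) less_imp_le[OF x(2)] a am _ r(2) p(2)]], goal_cases)
      case (3 s2)
      have rp2: "repr s2 Ls" using repr_frame[OF rp1 3(2)] by simp
      have f2: "arrs s2 aVal = arrs s aVal" "arrs s2 aF = arrs s aF"
        using 3(2) r by (auto simp: frame_def)
      have k2: "arrs s2 aKey i = key x (Ls ! i \<inter> K)" if "i < length Ls" for i
        using 3(1) that unfolding K' by blast
      show ?case
      proof (rule runs_For[where I = "\<lambda>j s'. \<forall>\<kappa>.
         (arrs s' aF \<kappa> = arrs s aF \<kappa> \<or>
           (\<exists>i<j. key x (Ls ! i \<inter> K) = \<kappa> \<and> arrs s' aF \<kappa> = arrs s aVal i)) \<and>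
         (\<forall>i<j. key x (Ls ! i \<inter> K) = \<kappa> \<longrightarrow> arrs s aVal i \<le> arrs s' aF \<kappa>)"], goal_cases)
        case 5
        then show ?case using f2 by simp
      next
        case (6 j s3)
        have f3: "arrs s3 aVal = arrs s aVal" "arrs s3 aKey = arrs s2 aKey"
          using 6(4) f2 by (auto simp: frame_def)
        have j: "j < length Ls" using 6(1) reprD(1)[OF rp2] by simp
        have kj: "arrs s3 aKey j = key x (Ls ! j \<inter> K)" using k2 j f3 by simp
        note step = running_max_step[OF 6(3)]
        show ?case
        proof ((rule runs_Cond; rule runs_Store runs_Skip), goal_cases)
          case 1
          then show ?case using step 6(2) kj f3(1) by (simp add: max_def)
        next
          case 2
          then have "max (arrs s3 aF (key x (Ls ! j \<inter> K))) (arrs s aVal j) = arrs s3 aF (key x (Ls ! j \<inter> K))"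
            using 6(2) kj f3(1) by (simp add: max_def)
          then show ?case using step by simp
        qed
      next
        case (7 s3)
        then show ?case using reprD(1)[OF rp2] by simp
      qed (use reprD(1)[OF rp2] B in auto)
    qed auto
  qed
  show ?thesis
    unfolding table_prog_def
    apply (rule runs_Seq, rule runs_Assign, rule runs_Seq, rule runs_Cond)
     apply (rule runs_Assign, rule main)
      apply (use p x st in \<open>auto simp: frame_def staticD\<close>)[2]
    apply (rule runs_Skip, rule main)
     apply (use p x st in \<open>auto simp: frame_def staticD\<close>)[2]
    done
qed

end

lemma step_writes [simp]:
  "rIt \<notin> wregs step_prog" "rM \<notin> wregs step_prog"
  by (simp_all add: step_prog_def)

section \<open>The invariant of the outer loop and the total time\<close>

context decomposition
begin

text \<open>The last clause guarantees that the cells of a node are still 0 when it is peeled, so no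
  stale value can enter its maxima.\<close>

definition processed :: "nat \<Rightarrow> state \<Rightarrow> bool" where
  "processed j s \<longleftrightarrow> static s \<and> card (removed s) = j \<and>
     (\<exists>par. peeled (removed s) par (table s) (regs s 0)) \<and>
     (\<forall>x<m. x \<notin> removed s \<longrightarrow> table s x = (\<lambda>_. 0))"

lemma processed_regs: "processed j (s\<lparr>regs := (regs s)(rIt := c)\<rparr>) = processed j s"
proof -
  let ?t = "s\<lparr>regs := (regs s)(rIt := c)\<rparr>"
  have "static ?t = static s" by (simp add: static_def)
  moreover have "removed ?t = removed s" by (simp add: removed_def)
  moreover have "table ?t = table s" by (intro ext) (simp add: table_def)
  moreover have "regs ?t 0 = regs s 0" by simp
  ultimately show ?thesis unfolding processed_def by (simp only:)
qed

lemma runs_step: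
  assumes pr: "processed j s" and j: "j < m"
    and B: "n * n \<le> B" "\<And>x. x < m \<Longrightarrow> card {A. A \<subseteq> bags (nbh x) \<and> indep A} \<le> B"
  shows "runs B step_prog s (processed (Suc j))"
proof -
  have B': "m \<le> B" using B(1) nodes by (meson le_square order_trans)
  have st: "static s" using pr by (simp add: processed_def)
  let ?R = "removed s"
  have Rm: "?R \<subseteq> {..<m}" by (auto simp: removed_def)
  have "card ?R = j" using pr by (simp add: processed_def)
  then have "?R \<noteq> {..<m}" using j card_lessThan[of m] by (metis less_irrefl)
  show ?thesis unfolding step_prog_def
  proof (rule runs_Seq'[OF runs_find[OF st B' \<open>?R \<noteq> {..<m}\<close>]], goal_cases)
    case (1 s1)
    define x p where "x = regs s1 rX" and "p = regs s1 rP"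
    have x: "x < m" "x \<notin> ?R" and p: "p \<le> m" "{y. adj x y \<and> y \<notin> ?R} = {p} \<inter> {..<m}"
      using 1(1) by (auto simp: x_def p_def)
    define K where "K = (if p < m then bag x \<union> bag p else {})"
    have st1: "static s1" using static_frame[OF st 1(2)] by simp
    note Bx = B(2)[OF x(1)]
    let ?Ls = "indep_list (bags (nbh x)) n"
    have set_Ls: "set ?Ls = {A. A \<subseteq> bags (nbh x) \<and> indep A}"
      unfolding set_indep_list[OF order_refl] using bag_subset by blast
    have len: "length ?Ls \<le> B" using length_indep_list[of n "bags (nbh x)"] Bx by simp
    show ?case
    proof (rule runs_Seq'[OF runs_list[OF st1 x_def[symmetric] x(1) B(1) Bx]], goal_cases)
      case (1 s2)
      have st2: "static s2" using static_frame[OF st1 1(2)] by simp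
      have x2: "regs s2 rX = x" and p2: "regs s2 rP = p" using 1(2) by (auto simp: frame_def x_def p_def)
      have rp2: "repr s2 ?Ls" by fact
      have F2: "arrs s2 aF = arrs s aF" "arrs s2 aRem = arrs s aRem" "regs s2 0 = regs s 0"
        using 1(2) \<open>frame (wregs find_prog) (warrs find_prog) s s1\<close> by (auto simp: frame_def)
      have tab2: "table s2 = table s" by (auto simp: table_def F2 intro!: ext)
      show ?case
      proof (rule runs_Seq'[OF runs_value[OF st2 rp2 len B' x2 x(1) p2]], goal_cases)
        case (1 s3)
        have st3: "static s3" using static_frame[OF st2 1(2)] by simp
        have x3: "regs s3 rX = x" and p3: "regs s3 rP = p" using 1(2) x2 p2 by (auto simp: frame_def)
        have rp3: "repr s3 ?Ls" using repr_frame[OF rp2 1(2)] by simp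
        have F3: "arrs s3 aF = arrs s aF" "arrs s3 aRem = arrs s aRem" "regs s3 0 = regs s 0"
          using 1(2) F2 by (auto simp: frame_def)
        define val where "val A = card (A \<inter> bag x) +
          (\<Sum>y | adj x y \<and> y \<noteq> p. table s y (A \<inter> (bag x \<union> bag y)))" for A
        have val: "arrs s3 aVal i = val (?Ls ! i)" if "i < length ?Ls" for i
          using 1(1) that unfolding val_def tab2 by blast
        show ?case
        proof (rule runs_Seq'[OF runs_table_prog[OF st3 rp3 len x3 x(1) p3 p(1) K_def]], goal_cases)
          case (1 s4)
          have st4: "static s4" using static_frame[OF st3 1(2)] by simp
          have x4: "regs s4 rX = x" and p4: "regs s4 rP = p" using 1(2) x3 p3 by (auto simp: frame_def)
          have F4: "arrs s4 aRem = arrs s aRem" "regs s4 0 = regs s 0"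
            using 1(2) F3 by (auto simp: frame_def)
          have max: "arrs s4 aF \<kappa> = arrs s aF \<kappa> \<or>
              (\<exists>i<length ?Ls. key x (?Ls ! i \<inter> K) = \<kappa> \<and> arrs s4 aF \<kappa> = val (?Ls ! i))"
            "i < length ?Ls \<Longrightarrow> key x (?Ls ! i \<inter> K) = \<kappa> \<Longrightarrow> val (?Ls ! i) \<le> arrs s4 aF \<kappa>" for \<kappa> i
            using spec[OF 1(1), of \<kappa>] val F3(1) by auto
          have Kn: "K \<subseteq> {..<n}" using bag_subset by (auto simp: K_def)
          have K_nbh: "K \<subseteq> bags (nbh x)"
            using p(2) by (auto simp: K_def nbh_def)
          define g where "g = table s4 x"
          have other: "table s4 = (table s)(x := g)"
          proof (intro ext)
            fix y S
            show "table s4 y S = ((table s)(x := g)) y S"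
            proof (cases "y \<noteq> x \<and> S \<subseteq> {..<n}")
              case True
              then have "key x (?Ls ! i \<inter> K) \<noteq> key y S" for i
                using key_inject[of x "?Ls ! i \<inter> K" y S] Kn by blast
              then have "arrs s4 aF (key y S) = arrs s aF (key y S)" using max(1) by blast
              then show ?thesis using True by (simp add: table_def)
            qed (auto simp: table_def g_def)
          qed
          have g0: "arrs s aF (key x S) = 0" if "S \<subseteq> {..<n}" for S
          proof -
            have "table s x S = 0" using pr x by (simp add: processed_def)
            then show ?thesis using that x by (simp add: table_def)
          qed
          have g: "(\<exists>A. A \<subseteq> bags (nbh x) \<and> indep A \<and> A \<inter> K = S \<and> val A = g S) \<and>
              (\<forall>A. A \<subseteq> bags (nbh x) \<longrightarrow> indep A \<longrightarrow> A \<inter> K = S \<longrightarrow> val A \<le> g S)"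
            if S: "S \<subseteq> K" "indep S" for S
          proof -
            have Sn: "S \<subseteq> {..<n}" using S Kn by blast
            have gS: "g S = arrs s4 aF (key x S)" using Sn x by (simp add: g_def table_def)
            have up: "val A \<le> g S" if "A \<subseteq> bags (nbh x)" "indep A" "A \<inter> K = S" for A
            proof -
              have "A \<in> set ?Ls" using that set_Ls by blast
              then obtain i where "i < length ?Ls" "?Ls ! i = A" by (auto simp: in_set_conv_nth)
              then show ?thesis using max(2)[of i "key x S"] that(3) gS by simp
            qed
            have SK: "S \<inter> K = S" "S \<subseteq> bags (nbh x)" using S K_nbh by blast+
            have "\<exists>A. A \<subseteq> bags (nbh x) \<and> indep A \<and> A \<inter> K = S \<and> val A = g S"
              using max(1)[of "key x S"]
            proof
              \<comment> \<open>An entry that kept its initial value is 0. It is nevertheless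
                attained: \<open>S\<close> itself is an admissible set with trace \<open>S\<close>,
                and its value is at most this entry.\<close>
              assume "arrs s4 aF (key x S) = arrs s aF (key x S)"
              then have "g S = 0" using g0[OF Sn] gS by simp
              then have "val S = g S" using up[OF SK(2) S(2) SK(1)] by simp
              then show ?thesis using S SK by blast
            next
              assume "\<exists>i<length ?Ls. key x (?Ls ! i \<inter> K) = key x S \<and> arrs s4 aF (key x S) = val (?Ls ! i)"
              then obtain i where i: "i < length ?Ls" "key x (?Ls ! i \<inter> K) = key x S" "g S = val (?Ls ! i)"
                using gS by auto
              have "?Ls ! i \<inter> K = S" using key_inject[OF i(2) _ Sn] Kn by blast
              moreover have "?Ls ! i \<in> {A. A \<subseteq> bags (nbh x) \<and> indep A}"
                unfolding set_Ls[symmetric] using i(1) by (rule nth_mem)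
              ultimately show ?thesis using i(3) by auto
            qed
            then show ?thesis using up by blast
          qed
          obtain par where par: "peeled ?R par (table s) (regs s 0)" using pr by (auto simp: processed_def)
          have peeled: "peeled (insert x ?R) (par(x := p)) ((table s)(x := g))
              (regs s 0 + (if p < m then 0 else g {}))"
            by (rule peeled_step[OF par x p K_def g val_def])
          have gE: "g {} = arrs s4 aF (2 ^ (n + x))" using x by (simp add: g_def table_def key_def)
          have fin: "processed (Suc j) t"
            if t: "frame {0} {aRem} s4 t" "regs t 0 = regs s 0 + (if p < m then 0 else g {})"
              "arrs t aRem = (arrs s aRem)(x := 1)" for t
          proof -
            have "static t" using static_frame[OF st4 t(1)] by simp
            moreover have R: "removed t = insert x ?R" using t(3) x(1) by (auto simp: removed_def)
            moreover have tab: "table t = (table s)(x := g)"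
            proof -
              have "arrs t aF = arrs s4 aF" using t(1) by (simp add: frame_def)
              then have "table t = table s4" by (intro ext) (simp add: table_def)
              then show ?thesis using other by simp
            qed
            moreover have "card (insert x ?R) = Suc j"
              using x(2) Rm \<open>card ?R = j\<close> by (simp add: finite_subset)
            moreover have "\<forall>y<m. y \<notin> insert x ?R \<longrightarrow> ((table s)(x := g)) y = (\<lambda>_. 0)"
              using pr by (simp add: processed_def)
            ultimately show ?thesis
              unfolding processed_def using peeled t(2) by auto
          qed
          show ?case
            apply (rule runs_Seq, rule runs_Cond)
             apply (rule runs_Assign, rule runs_Store, rule fin)
               apply (use st4 x4 p4 F4 gE x p staticD(7)[OF st4, of "n + x"] in \<open>auto simp: frame_def staticD\<close>)[3]
            apply (rule runs_Skip, rule runs_Store, rule fin)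
              apply (use st4 x4 p4 F4 p in \<open>auto simp: frame_def staticD\<close>)[3]
            done
        qed
      qed
    qed
  qed
qed

lemma runs_alpha:
  assumes B: "n * n \<le> B" "n + m \<le> B"
    "\<And>x. x < m \<Longrightarrow> card {A. A \<subseteq> bags (nbh x) \<and> indep A} \<le> B"
  shows "runs B alpha_prog (init_state (encode_instance n m \<rho> G T C)) (\<lambda>s. result s = alpha (2 * \<rho>) G)"
  unfolding alpha_prog_def
proof (rule runs_Seq'[OF runs_setup[OF B(2)]], goal_cases)
  case (1 s1)
  have st1: "static s1" using 1 by blast
  have zero: "regs s1 0 = 0" "arrs s1 aRem = (\<lambda>_. 0)" "arrs s1 aF = (\<lambda>_. 0)" using 1 by auto
  show ?case
  proof (rule runs_For[where I = processed], goal_cases)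
    case 5
    have "removed s1 = {}" using zero by (simp add: removed_def)
    moreover have "table s1 x = (\<lambda>_. 0)" for x using zero by (auto simp: table_def)
    ultimately have "processed 0 s1"
      using st1 peeled_init zero(1) by (simp add: processed_def)
    then show ?case by (simp only: processed_regs)
  next
    case (6 j s2)
    then have "j < m" using st1 by (simp add: staticD)
    then show ?case using runs_step[OF 6(3) _ B(1,3)] by (simp only: processed_regs)
  next
    case (7 s2)
    then have pr: "processed m s2" using st1 by (simp add: staticD)
    have "removed s2 \<subseteq> {..<m}" by (auto simp: removed_def)
    moreover have "card (removed s2) = m" using pr by (simp add: processed_def)
    ultimately have "removed s2 = {..<m}" by (metis card_lessThan card_subset_eq finite_lessThan)
    then show ?case using pr peeled_final by (auto simp: processed_def result_def)
  qed (use st1 B in \<open>auto simp: staticD\<close>)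
qed

text \<open>The loop bound is \<open>B = 2 * n ^ (4 * d * k)\<close>. Positive width and degree
  bound make the exponent at least 2, so \<open>B\<close> also covers \<open>n * n\<close> and
  \<open>n + m\<close>; the factor \<open>3 ^ cdepth alpha_prog\<close> comes from
  \<open>Suc B \<le> 3 * n ^ (4 * d * k)\<close>.\<close>

lemma alpha_time:
  assumes k: "decomp_width \<rho> G T C \<le> k" and d: "max_degree T \<le> d" "0 < d"
  shows "\<exists>t s. exec alpha_prog (init_state (encode_instance n m \<rho> G T C)) t s \<and>
     result s = alpha (2 * \<rho>) G \<and>
     t \<le> csize alpha_prog * 3 ^ cdepth alpha_prog * n ^ (4 * d * k * cdepth alpha_prog)"
proof -
  let ?N = "n ^ (4 * d * k)" and ?D = "cdepth alpha_prog"
  have n: "0 < n" using nodes by simp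
  have "0 < k" using width_pos k by simp
  then have e: "2 \<le> 4 * d * k" using d(2) by (cases d; cases k) auto
  have "n * n \<le> ?N" using power_increasing[OF e, of n] n by (simp add: power2_eq_square)
  moreover have "n \<le> ?N" using power_increasing[of 1 "4 * d * k" n] e n by simp
  ultimately have "runs (2 * ?N) alpha_prog (init_state (encode_instance n m \<rho> G T C))
      (\<lambda>s. result s = alpha (2 * \<rho>) G)"
    using nodes(2) card_indep_sets[OF _ k d] by (intro runs_alpha) auto
  then obtain t s where ts: "exec alpha_prog (init_state (encode_instance n m \<rho> G T C)) t s"
    "t \<le> csize alpha_prog * Suc (2 * ?N) ^ ?D" "result s = alpha (2 * \<rho>) G"
    unfolding runs_def by blast
  have "Suc (2 * ?N) \<le> 3 * ?N" using n by (simp add: Suc_le_eq)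
  then have "Suc (2 * ?N) ^ ?D \<le> (3 * ?N) ^ ?D" by (rule power_mono) simp
  also have "\<dots> = 3 ^ ?D * n ^ (4 * d * k * ?D)" by (simp only: power_mult_distrib power_mult)
  finally have "csize alpha_prog * Suc (2 * ?N) ^ ?D \<le> csize alpha_prog * 3 ^ ?D * n ^ (4 * d * k * ?D)"
    unfolding mult.assoc[of "csize alpha_prog"] by (rule mult_left_mono) simp
  then show ?thesis using ts order_trans by blast
qed

end

theorem theorem1p3:
  "\<exists>(p :: com) (c :: nat).
     \<forall>(n :: nat) (m :: nat) (\<rho> :: nat) (k :: nat) (\<Delta> :: nat)
       (G :: nat graph) (T :: nat graph) (C :: nat \<Rightarrow> nat set).
       simple_graph G \<and> verts G = {..<n} \<and> verts T = {..<m} \<and>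
       0 < \<rho> \<and> 0 < \<Delta> \<and>
       tree_partition_decomp \<rho> G T C \<and>
       decomp_width \<rho> G T C \<le> k \<and> max_degree T \<le> \<Delta> \<longrightarrow>
       (\<exists>t s. exec p (init_state (encode_instance n m \<rho> G T C)) t s \<and>
              result s = alpha (2 * \<rho>) G \<and>
              t \<le> c * n ^ (c * \<Delta> * k))"
proof -
  define a D where "a = csize alpha_prog * 3 ^ cdepth alpha_prog" and "D = cdepth alpha_prog"
  \<comment> \<open>A single constant has to serve twice: \<open>a\<close> bounds the leading factor
    and \<open>4 * D\<close> the exponent.\<close>
  define c where "c = a + 4 * D"
  have "\<exists>t s. exec alpha_prog (init_state (encode_instance n m \<rho> G T C)) t s \<and>
      result s = alpha (2 * \<rho>) G \<and> t \<le> c * n ^ (c * \<Delta> * k)"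
    if *: "simple_graph G \<and> verts G = {..<n} \<and> verts T = {..<m} \<and> 0 < \<rho> \<and> 0 < \<Delta> \<and>
       tree_partition_decomp \<rho> G T C \<and> decomp_width \<rho> G T C \<le> k \<and> max_degree T \<le> \<Delta>"
    for n m \<rho> k \<Delta> :: nat and G T :: "nat graph" and C
  proof -
    interpret decomposition n m \<rho> G T C using * by unfold_locales auto
    obtain t s where ts: "exec alpha_prog (init_state (encode_instance n m \<rho> G T C)) t s"
      "result s = alpha (2 * \<rho>) G" "t \<le> a * n ^ (4 * \<Delta> * k * D)"
      using alpha_time[of k \<Delta>] * by (auto simp: a_def D_def)
    have "a * n ^ (4 * \<Delta> * k * D) \<le> c * n ^ (c * \<Delta> * k)"
    proof (rule mult_mono)
      have "4 * \<Delta> * k * D = 4 * D * \<Delta> * k" by simp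
      also have "\<dots> \<le> c * \<Delta> * k" by (intro mult_right_mono) (simp_all add: c_def)
      finally show "n ^ (4 * \<Delta> * k * D) \<le> n ^ (c * \<Delta> * k)"
        using nodes by (intro power_increasing) auto
    qed (auto simp: c_def)
    then show ?thesis using ts by (meson order_trans)
  qed
  then show ?thesis by blast
qed

end
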